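(* Let $K=\mathbb{Q}(\sqrt{-7})$. The $7$-tent graph is a forest of trees in which every vertex has valence $3$. Consequently the group generated by the three matrices $$\begin{pmatrix}0&1&0&0\\1&0&0&0\\0&0&0&1\\0&0&1&0\end{pmatrix},\quad \begin{pmatrix}-2&0&0&-1\\3&0&1&2\\0&1&0&-1\\3&0&0&2\end{pmatrix},\quad \begin{pmatrix}0&-1&0&1\\0&2&3&0\\0&-1&-2&0\\1&2&3&0\end{pmatrix}$$ is freely generated by them as a free product of three copies of $\mathbb{Z}/2\mathbb{Z}$.
   Context: Every oriented circle $C$ in $\widehat{\mathbb{C}}$ (lines included) is uniquely $\{X/Y: bX\overline{X}-aY\overline{X}-\overline{a}X\overline{Y}+b'Y\overline{Y}=0\}$ with $b,b'\in\mathbb{R}$, $a\in\mathbb{C}$, $bb'=|a|^2-1$, sign of $b$ = orientation (positive = counterclockwise), and for lines $a$ the unit normal pointing from exterior to interior (interior = left of direction of travel). Set $\pi(C)=(b',b,\mathrm{Re}\,a,\mathrm{Im}\,a)$ and define the Pedoe product $\langle(b'_1,b_1,r_1,m_1),(b'_2,b_2,r_2,m_2)\rangle=-\tfrac12(b'_1b_2+b_1b'_2)+r_1r_2+m_1m_2$. A $\mathbb{Q}(\sqrt{-7})$-Bianchi circle is $M(\widehat{\mathbb{R}})$ with $M\in\mathrm{PSL}_2(\mathcal{O}_K)$. A tent is a 5-tuple $(C_1,\dots,C_5)$ of oriented $\mathbb{Q}(\sqrt{-7})$-Bianchi circles whose Pedoe product matrix $(\langle\pi(C_i),\pi(C_j)\rangle)$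 has rows $(1,-1,-\tfrac52,-1,-\tfrac52)$, $(-1,1,-1,-\tfrac52,-1)$, $(-\tfrac52,-1,1,-1,-\tfrac52)$, $(-1,-\tfrac52,-1,1,-1)$, $(-\tfrac52,-1,-\tfrac52,-1,1)$. Its peaks are $C_1,C_3,C_5$; a belt of the tent is the set of four circles remaining after removing one peak. The $7$-tent graph has as vertices all tents considered as unordered sets of circles, with an edge between two tents sharing a belt. The three matrices act by right multiplication on the $4\times4$ matrices with columns $\pi(C_1),\pi(C_2),\pi(C_3),\pi(C_4)$ of a tent, each realising the replacement of a tent by the other tent sharing one of its belts. *)

theory Defs
  imports
    "HOL-Analysis.Analysis"
    "HOL-Algebra.Elementary_Groups"
    "HOL-Computational_Algebra.Polynomial"
begin

section \<open>Oriented circles in the Riemann sphere\<close>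

text \<open>
  The Riemann sphere is \<^typ>\<open>complex option\<close>, with \<^const>\<open>None\<close> the point at infinity.
  The oriented circles are given as pairs of point sets: the points of the circle, and its
  interior, which is the component of the complement to the left of the direction of travel.  The
  orientation determines the interior and conversely.
\<close>

type_synonym sphere_pt = "complex option"
type_synonym ocircle = "sphere_pt set \<times> sphere_pt set"

definition ccw_circle :: "complex \<Rightarrow> real \<Rightarrow> ocircle" where
  "ccw_circle c r = (Some ` sphere c r, Some ` ball c r)"

definition cw_circle :: "complex \<Rightarrow> real \<Rightarrow> ocircle" where
  "cw_circle c r = (Some ` sphere c r, - (Some ` cball c r))"

text \<open>The line with unit normal \<open>n\<close> pointing from the exterior to the interior.\<close>

definition oriented_line :: "complex \<Rightarrow> real \<Rightarrow> ocircle" where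
  "oriented_line n t = (insert None (Some ` {z. n \<bullet> z = t}), Some ` {z. n \<bullet> z > t})"

definition oriented_circles :: "ocircle set" where
  "oriented_circles =
     {ccw_circle c r | c r. r > 0} \<union> {cw_circle c r | c r. r > 0} \<union>
     {oriented_line n t | n t. norm n = 1}"

definition ratio :: "complex \<Rightarrow> complex \<Rightarrow> sphere_pt" where
  "ratio X Y = (if Y = 0 then None else Some (X / Y))"

definition circle_form :: "real \<Rightarrow> real \<Rightarrow> complex \<Rightarrow> complex \<Rightarrow> complex \<Rightarrow> complex" where
  "circle_form b' b a X Y =
     of_real b * X * cnj X - a * Y * cnj X - cnj a * X * cnj Y + of_real b' * Y * cnj Y"

definition circle_locus :: "real \<Rightarrow> real \<Rightarrow> complex \<Rightarrow> sphere_pt set" where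
  "circle_locus b' b a = {ratio X Y | X Y. (X, Y) \<noteq> (0, 0) \<and> circle_form b' b a X Y = 0}"

definition is_circle_data :: "ocircle \<Rightarrow> real \<Rightarrow> real \<Rightarrow> complex \<Rightarrow> bool" where
  "is_circle_data C b' b a \<longleftrightarrow>
     b * b' = (cmod a)\<^sup>2 - 1 \<and>
     fst C = circle_locus b' b a \<and>
     (\<forall>c r. r > 0 \<and> C = ccw_circle c r \<longrightarrow> b > 0) \<and>
     (\<forall>c r. r > 0 \<and> C = cw_circle c r \<longrightarrow> b < 0) \<and>
     (\<forall>n t. norm n = 1 \<and> C = oriented_line n t \<longrightarrow> a = n)"

definition pi_vec :: "ocircle \<Rightarrow> real^4" where
  "pi_vec C = (THE v. \<exists>b' b a. is_circle_data C b' b a \<and> v = vector [b', b, Re a, Im a])"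

definition pedoe :: "real^4 \<Rightarrow> real^4 \<Rightarrow> real" where
  "pedoe u v = - (1/2) * (u$1 * v$2 + u$2 * v$1) + u$3 * v$3 + u$4 * v$4"


subsection \<open>Existence and uniqueness of the circle data\<close>

lemma Some_in_circle_locus:
  "Some z \<in> circle_locus b' b a \<longleftrightarrow> b * (cmod z)\<^sup>2 - 2 * (a \<bullet> z) + b' = 0"
proof -
  have form: "circle_form b' b a X Y =
      of_real (b * (cmod (X / Y))\<^sup>2 - 2 * (a \<bullet> (X / Y)) + b') * (Y * cnj Y)" if "Y \<noteq> 0" for X Y
  proof -
    define w where "w = X / Y"
    have X: "X = w * Y" using that by (simp add: w_def)
    have 1: "of_real ((cmod w)\<^sup>2) = w * cnj w"
      using complex_norm_square by simp
    have 2: "of_real (2 * (a \<bullet> w)) = a * cnj w + cnj a * w"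
      by (simp add: complex_eq_iff inner_complex_def algebra_simps)
    have "circle_form b' b a X Y = (of_real b * (w * cnj w) - (a * cnj w + cnj a * w) + of_real b')
      * (Y * cnj Y)"
      unfolding circle_form_def X by (simp add: algebra_simps)
    also have "of_real b * (w * cnj w) - (a * cnj w + cnj a * w) + of_real b' =
      complex_of_real (b * (cmod w)\<^sup>2 - 2 * (a \<bullet> w) + b')"
      unfolding 1[symmetric] 2[symmetric] by simp
    finally show ?thesis unfolding w_def .
  qed
  show ?thesis
  proof
    assume "Some z \<in> circle_locus b' b a"
    then obtain X Y where *: "Some z = ratio X Y" "circle_form b' b a X Y = 0"
      by (auto simp: circle_locus_def)
    then have "Y \<noteq> 0" "z = X / Y" by (auto simp: ratio_def split: if_splits)
    with * form[of Y X] show "b * (cmod z)\<^sup>2 - 2 * (a \<bullet> z) + b' = 0"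
      by (metis mult_eq_0_iff of_real_eq_0_iff complex_cnj_zero_iff)
  next
    assume "b * (cmod z)\<^sup>2 - 2 * (a \<bullet> z) + b' = 0"
    then have "circle_form b' b a z 1 = 0" using form[of 1 z] by simp
    moreover have "Some z = ratio z 1" by (simp add: ratio_def)
    ultimately show "Some z \<in> circle_locus b' b a"
      unfolding circle_locus_def by fastforce
  qed
qed

lemma None_in_circle_locus: "None \<in> circle_locus b' b a \<longleftrightarrow> b = 0"
proof
  assume "None \<in> circle_locus b' b a"
  then obtain X where "X \<noteq> 0" "circle_form b' b a X 0 = 0"
    by (auto simp: circle_locus_def ratio_def split: if_splits)
  then show "b = 0" by (simp add: circle_form_def)
next
  assume "b = 0"
  then have "circle_form b' b a 1 0 = 0" "ratio 1 0 = None"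
    by (simp_all add: circle_form_def ratio_def)
  then show "None \<in> circle_locus b' b a"
    unfolding circle_locus_def by (metis (mono_tags, lifting) mem_Collect_eq old.prod.inject one_neq_zero)
qed

lemma circle_locus_circle:
  assumes "b \<noteq> 0" "b * b' = (cmod a)\<^sup>2 - 1"
  shows "circle_locus b' b a = Some ` sphere (a / of_real b) (1 / \<bar>b\<bar>)"
proof -
  have "Some z \<in> circle_locus b' b a \<longleftrightarrow> z \<in> sphere (a / of_real b) (1 / \<bar>b\<bar>)" for z
  proof -
    have "z \<in> sphere (a / of_real b) (1 / \<bar>b\<bar>) \<longleftrightarrow> (cmod (z - a / of_real b))\<^sup>2 = (1 / \<bar>b\<bar>)\<^sup>2"
      by (simp add: dist_norm norm_minus_commute power2_eq_iff_nonneg)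
    also have "\<dots> \<longleftrightarrow> b\<^sup>2 * (cmod (z - a / of_real b))\<^sup>2 = 1"
      using assms(1) by (simp add: field_simps)
    also have "b\<^sup>2 * (cmod (z - a / of_real b))\<^sup>2 = (cmod (of_real b * z - a))\<^sup>2"
    proof -
      have "of_real b * z - a = of_real b * (z - a / of_real b)"
        using assms(1) by (simp add: field_simps)
      then show ?thesis by (simp only: norm_mult power_mult_distrib) simp
    qed
    also have "\<dots> = b * (b * (cmod z)\<^sup>2 - 2 * (a \<bullet> z)) + (cmod a)\<^sup>2"
      unfolding cmod_power2 by (simp add: inner_complex_def power2_eq_square algebra_simps)
    also have "\<dots> = b * (b * (cmod z)\<^sup>2 - 2 * (a \<bullet> z) + b') + 1"
      using assms(2) by (simp add: algebra_simps)
    finally show ?thesis using assms(1) by (simp add: Some_in_circle_locus)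
  qed
  moreover have "None \<notin> circle_locus b' b a" using assms(1) by (simp add: None_in_circle_locus)
  ultimately show ?thesis
    by (auto simp del: mem_sphere) (metis imageI not_Some_eq)
qed

lemma circle_locus_line:
  "circle_locus b' 0 a = insert None (Some ` {z. a \<bullet> z = b' / 2})"
proof (rule Set.set_eqI)
  fix p show "p \<in> circle_locus b' 0 a \<longleftrightarrow> p \<in> insert None (Some ` {z. a \<bullet> z = b' / 2})"
    by (cases p) (auto simp: Some_in_circle_locus None_in_circle_locus)
qed

lemma complex_sphere_eqD:
  fixes c d :: complex
  assumes "sphere c r = sphere d s" "r > 0" "s > 0"
  shows "c = d" "r = s"
proof -
  have "c + of_real r \<in> sphere c r" "c - of_real r \<in> sphere c r"
    "c + \<i> * of_real r \<in> sphere c r" "c - \<i> * of_real r \<in> sphere c r"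
    using assms(2) by (simp_all add: dist_norm norm_mult)
  then have "(cmod (d - (c + of_real r)))\<^sup>2 = s\<^sup>2" "(cmod (d - (c - of_real r)))\<^sup>2 = s\<^sup>2"
    "(cmod (d - (c + \<i> * of_real r)))\<^sup>2 = s\<^sup>2" "(cmod (d - (c - \<i> * of_real r)))\<^sup>2 = s\<^sup>2"
    unfolding assms(1) by (simp_all add: dist_norm)
  then have *: "(Re d - Re c - r)\<^sup>2 + (Im d - Im c)\<^sup>2 = s\<^sup>2"
    "(Re d - Re c + r)\<^sup>2 + (Im d - Im c)\<^sup>2 = s\<^sup>2"
    "(Re d - Re c)\<^sup>2 + (Im d - Im c - r)\<^sup>2 = s\<^sup>2"
    "(Re d - Re c)\<^sup>2 + (Im d - Im c + r)\<^sup>2 = s\<^sup>2"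
    by (simp_all add: cmod_power2 algebra_simps)
  have "4 * r * (Re d - Re c) = 0"
    using *(1,2) by (simp only: power2_eq_square ring_distribs left_diff_distrib right_diff_distrib
        mult.commute mult.left_commute, linarith?)
  then have re: "Re d = Re c" using assms(2) by simp
  have "4 * r * (Im d - Im c) = 0"
    using *(3,4) by (simp only: power2_eq_square ring_distribs left_diff_distrib right_diff_distrib
        mult.commute mult.left_commute, linarith?)
  then have im: "Im d = Im c" using assms(2) by simp
  show "c = d" using re im by (simp add: complex_eq_iff)
  from *(1) re im have "r\<^sup>2 = s\<^sup>2" by simp
  then show "r = s" using assms(2,3) by (simp add: power2_eq_iff_nonneg)
qed

lemma ccw_neq_cw: "ccw_circle c r \<noteq> cw_circle d s"
  by (auto simp: ccw_circle_def cw_circle_def)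

lemma circle_neq_line: "ccw_circle c r \<noteq> oriented_line n t" "cw_circle c r \<noteq> oriented_line n t"
  by (auto simp: ccw_circle_def cw_circle_def oriented_line_def)

lemma oriented_line_inj:
  assumes "oriented_line n t = oriented_line m s" "norm n = 1" "norm m = 1"
  shows "n = m" "t = s"
proof -
  have nn: "n \<bullet> n = 1" "m \<bullet> m = 1" using assms(2,3) by (simp_all add: dot_square_norm)
  have on: "n \<bullet> z = t \<longleftrightarrow> m \<bullet> z = s" and int: "n \<bullet> z > t \<longleftrightarrow> m \<bullet> z > s" for z
  proof -
    have "Some z \<in> fst (oriented_line n t) \<longleftrightarrow> Some z \<in> fst (oriented_line m s)"
      "Some z \<in> snd (oriented_line n t) \<longleftrightarrow> Some z \<in> snd (oriented_line m s)"
      using assms(1) by simp_all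
    then show "n \<bullet> z = t \<longleftrightarrow> m \<bullet> z = s" "n \<bullet> z > t \<longleftrightarrow> m \<bullet> z > s"
      by (simp_all add: oriented_line_def image_iff)
  qed
  have "m \<bullet> (t *\<^sub>R n) = s" using on[of "t *\<^sub>R n"] nn by simp
  moreover have "n \<bullet> (s *\<^sub>R m) = t" using on[of "s *\<^sub>R m"] nn by simp
  moreover have "n \<bullet> (t *\<^sub>R n + (m - (n \<bullet> m) *\<^sub>R n)) = t"
    using nn by (simp add: inner_diff_right inner_add_right)
  then have "m \<bullet> (t *\<^sub>R n + (m - (n \<bullet> m) *\<^sub>R n)) = s" using on by blast
  ultimately have "1 - (n \<bullet> m)\<^sup>2 = 0"
    using nn by (simp add: inner_diff_right inner_add_right inner_commute power2_eq_square)
  then have "n \<bullet> m = 1 \<or> n \<bullet> m = -1" by (simp add: power2_eq_1_iff)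
  moreover have "n \<bullet> m \<noteq> -1"
  proof
    assume "n \<bullet> m = -1"
    then have st: "s = - t" using \<open>m \<bullet> (t *\<^sub>R n) = s\<close> by (simp add: inner_commute)
    have "n \<bullet> ((t + 1) *\<^sub>R n) > t" using nn by simp
    then have "m \<bullet> ((t + 1) *\<^sub>R n) > s" using int by blast
    with \<open>n \<bullet> m = -1\<close> st show False by (simp add: inner_commute)
  qed
  ultimately have nm: "n \<bullet> m = 1" by blast
  then have "(n - m) \<bullet> (n - m) = 0" using nn by (simp add: inner_diff inner_commute)
  then show "n = m" by simp
  from nm \<open>m \<bullet> (t *\<^sub>R n) = s\<close> show "t = s" by (simp add: inner_commute)
qed

lemma is_circle_data_ccw:
  assumes "r > 0"
  shows "is_circle_data (ccw_circle c r) b' b a \<longleftrightarrow>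
    b = 1 / r \<and> a = c / of_real r \<and> b' = ((cmod c)\<^sup>2 - r\<^sup>2) / r"
proof
  assume L: "is_circle_data (ccw_circle c r) b' b a"
  then have b: "b > 0" and d: "b * b' = (cmod a)\<^sup>2 - 1"
    using assms unfolding is_circle_data_def by blast+
  from L have loc: "Some ` sphere c r = circle_locus b' b a"
    by (simp add: is_circle_data_def ccw_circle_def)
  have "sphere c r = sphere (a / of_real b) (1 / b)"
    using circle_locus_circle[of b b' a] b d loc by (simp add: inj_image_eq_iff)
  from complex_sphere_eqD[OF this] have "c = a / of_real b" and r: "r = 1 / b" using assms b by auto
  then have br: "b = 1 / r" and a: "a = c / of_real r" using b by simp_all
  have "b' = ((cmod a)\<^sup>2 - 1) / b" using d b by (simp add: field_simps)
  also have "\<dots> = ((cmod c)\<^sup>2 - r\<^sup>2) / r"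
    using assms by (simp add: a br norm_divide field_simps power2_eq_square)
  finally show "b = 1 / r \<and> a = c / of_real r \<and> b' = ((cmod c)\<^sup>2 - r\<^sup>2) / r"
    using br a by blast
next
  assume R: "b = 1 / r \<and> a = c / of_real r \<and> b' = ((cmod c)\<^sup>2 - r\<^sup>2) / r"
  then have b: "b = 1 / r" and a: "a = c / of_real r" and b': "b' = ((cmod c)\<^sup>2 - r\<^sup>2) / r"
    by simp_all
  have d: "b * b' = (cmod a)\<^sup>2 - 1"
    unfolding a b b' using assms by (simp add: norm_divide field_simps power2_eq_square)
  moreover have "fst (ccw_circle c r) = circle_locus b' b a"
    using circle_locus_circle[of b b' a] R d assms by (simp add: ccw_circle_def)
  moreover have "b > 0" using R assms by simp
  ultimately show "is_circle_data (ccw_circle c r) b' b a"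
    unfolding is_circle_data_def using ccw_neq_cw circle_neq_line by blast
qed

lemma is_circle_data_cw:
  assumes "r > 0"
  shows "is_circle_data (cw_circle c r) b' b a \<longleftrightarrow>
    b = - 1 / r \<and> a = - c / of_real r \<and> b' = - ((cmod c)\<^sup>2 - r\<^sup>2) / r"
proof
  assume L: "is_circle_data (cw_circle c r) b' b a"
  then have b: "b < 0" and d: "b * b' = (cmod a)\<^sup>2 - 1"
    using assms unfolding is_circle_data_def by blast+
  from L have loc: "Some ` sphere c r = circle_locus b' b a"
    by (simp add: is_circle_data_def cw_circle_def)
  have "sphere c r = sphere (a / of_real b) (1 / - b)"
    using circle_locus_circle[of b b' a] b d loc by (simp add: inj_image_eq_iff)
  from complex_sphere_eqD[OF this] have "c = a / of_real b" and r: "r = 1 / - b"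
    using assms b by (auto simp: field_simps)
  then have br: "b = - 1 / r" and a: "a = - c / of_real r" using b by simp_all
  have "b' = ((cmod a)\<^sup>2 - 1) / b" using d b by (simp add: field_simps)
  also have "\<dots> = - ((cmod c)\<^sup>2 - r\<^sup>2) / r"
    using assms by (simp add: a br norm_divide field_simps power2_eq_square)
  finally show "b = - 1 / r \<and> a = - c / of_real r \<and> b' = - ((cmod c)\<^sup>2 - r\<^sup>2) / r"
    using br a by blast
next
  assume R: "b = - 1 / r \<and> a = - c / of_real r \<and> b' = - ((cmod c)\<^sup>2 - r\<^sup>2) / r"
  then have b: "b = - 1 / r" and a: "a = - c / of_real r" and b': "b' = - ((cmod c)\<^sup>2 - r\<^sup>2) / r"
    by simp_all
  have d: "b * b' = (cmod a)\<^sup>2 - 1"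
    unfolding a b b' using assms by (simp add: norm_divide field_simps power2_eq_square)
  moreover have "fst (cw_circle c r) = circle_locus b' b a"
    using circle_locus_circle[of b b' a] R d assms by (simp add: cw_circle_def)
  moreover have "b < 0" using R assms by simp
  ultimately show "is_circle_data (cw_circle c r) b' b a"
    unfolding is_circle_data_def using ccw_neq_cw circle_neq_line by metis
qed

lemma is_circle_data_line:
  assumes "norm n = 1"
  shows "is_circle_data (oriented_line n t) b' b a \<longleftrightarrow> b = 0 \<and> a = n \<and> b' = 2 * t"
proof
  assume L: "is_circle_data (oriented_line n t) b' b a"
  then have a: "a = n"
    and loc: "insert None (Some ` {z. n \<bullet> z = t}) = circle_locus b' b a"
    using assms unfolding is_circle_data_def oriented_line_def by auto
  then have "None \<in> circle_locus b' b a" by blast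
  then have b: "b = 0" by (simp add: None_in_circle_locus)
  have "n \<bullet> (t *\<^sub>R n) = t" using assms by (simp add: dot_square_norm)
  then have "Some (t *\<^sub>R n) \<in> circle_locus b' b a" unfolding loc[symmetric] by blast
  then have "b' = 2 * t" using \<open>n \<bullet> (t *\<^sub>R n) = t\<close> a b by (simp add: Some_in_circle_locus)
  with a b show "b = 0 \<and> a = n \<and> b' = 2 * t" by blast
next
  assume R: "b = 0 \<and> a = n \<and> b' = 2 * t"
  then have "fst (oriented_line n t) = circle_locus b' b a"
    by (simp add: circle_locus_line oriented_line_def)
  moreover have "b * b' = (cmod a)\<^sup>2 - 1" using R assms by simp
  ultimately show "is_circle_data (oriented_line n t) b' b a"
    unfolding is_circle_data_def
    using R assms oriented_line_inj circle_neq_line by metis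
qed

lemma pi_vec_ccw:
  "r > 0 \<Longrightarrow> pi_vec (ccw_circle c r) = vector [((cmod c)\<^sup>2 - r\<^sup>2) / r, 1 / r, Re c / r, Im c / r]"
  unfolding pi_vec_def by (rule the_equality) (auto simp: is_circle_data_ccw)

lemma pi_vec_cw:
  "r > 0 \<Longrightarrow> pi_vec (cw_circle c r) =
    vector [- ((cmod c)\<^sup>2 - r\<^sup>2) / r, - 1 / r, - Re c / r, - Im c / r]"
  unfolding pi_vec_def by (rule the_equality) (auto simp: is_circle_data_cw)

lemma pi_vec_line:
  "norm n = 1 \<Longrightarrow> pi_vec (oriented_line n t) = vector [2 * t, 0, Re n, Im n]"
  unfolding pi_vec_def by (rule the_equality) (auto simp: is_circle_data_line)

theorem circle_data_unique:
  assumes "C \<in> oriented_circles"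
  shows "\<exists>!(b', b, a). is_circle_data C b' b a"
  using assms by (auto simp: oriented_circles_def is_circle_data_ccw is_circle_data_cw
      is_circle_data_line)


section \<open>Bianchi circles\<close>

definition K7 :: "complex set" where
  "K7 = {of_rat p + of_rat q * (\<i> * of_real (sqrt 7)) | p q. True}"

definition O_K7 :: "complex set" where
  "O_K7 = {z \<in> K7. algebraic_int z}"

definition SL2_O_K7 :: "(complex^2^2) set" where
  "SL2_O_K7 = {M. (\<forall>i j. M $ i $ j \<in> O_K7) \<and> det M = 1}"

definition moebius_map :: "complex^2^2 \<Rightarrow> sphere_pt \<Rightarrow> sphere_pt" where
  "moebius_map M p =
     (case p of
        None \<Rightarrow> ratio (M$1$1) (M$2$1)
      | Some z \<Rightarrow> ratio (M$1$1 * z + M$1$2) (M$2$1 * z + M$2$2))"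

definition real_line :: "sphere_pt set" where
  "real_line = insert None (Some ` \<real>)"

text \<open>
  Matrices that differ by a sign induce the same Moebius transformation, so images under
  \<open>PSL\<^sub>2\<close> are images under \<open>SL\<^sub>2\<close>.
\<close>

lemma moebius_minus: "moebius_map (- M) = moebius_map M"
proof
  fix p
  have *: "ratio (- X) (- Y) = ratio X Y" for X Y by (simp add: ratio_def)
  show "moebius_map (- M) p = moebius_map M p"
  proof (cases p)
    case None
    then show ?thesis by (simp add: moebius_map_def *)
  next
    case (Some z)
    then show ?thesis
      using *[of "M$1$1 * z + M$1$2" "M$2$1 * z + M$2$2"] by (simp add: moebius_map_def)
  qed
qed

text \<open>
  Being a Bianchi circle is a property of the point set only; an oriented Bianchi circle carries
  either of the two orientations.
\<close>

definition bianchi_circle :: "sphere_pt set \<Rightarrow> bool" where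
  "bianchi_circle S \<longleftrightarrow> (\<exists>M \<in> SL2_O_K7. S = moebius_map M ` real_line)"

definition oriented_bianchi_circles :: "ocircle set" where
  "oriented_bianchi_circles = {C \<in> oriented_circles. bianchi_circle (fst C)}"


section \<open>Tents and the tent graph\<close>

definition tent_products :: "real list list" where
  "tent_products =
     [[   1,   -1, -5/2,   -1, -5/2],
      [  -1,    1,   -1, -5/2,   -1],
      [-5/2,   -1,    1,   -1, -5/2],
      [  -1, -5/2,   -1,    1,   -1],
      [-5/2,   -1, -5/2,   -1,    1]]"

text \<open>Lists are indexed from 0, so the peaks of a tent \<open>Cs\<close> are \<open>Cs ! 0\<close>, \<open>Cs ! 2\<close>, \<open>Cs ! 4\<close>.\<close>

definition tent :: "ocircle list \<Rightarrow> bool" where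
  "tent Cs \<longleftrightarrow> length Cs = 5 \<and> set Cs \<subseteq> oriented_bianchi_circles \<and>
     (\<forall>i<5. \<forall>j<5. pedoe (pi_vec (Cs ! i)) (pi_vec (Cs ! j)) = tent_products ! i ! j)"

definition belts :: "ocircle set \<Rightarrow> ocircle set set" where
  "belts T = {T - {P} | P Cs. tent Cs \<and> set Cs = T \<and> P \<in> {Cs ! 0, Cs ! 2, Cs ! 4}}"

definition tent_vertices :: "ocircle set set" where
  "tent_vertices = {set Cs | Cs. tent Cs}"

definition tent_edges :: "ocircle set set set" where
  "tent_edges = {{T, T'} | T T'. T \<in> tent_vertices \<and> T' \<in> tent_vertices \<and> T \<noteq> T' \<and>
     belts T \<inter> belts T' \<noteq> {}}"

text \<open>A simple graph (without loops) is given by its set of edges, each of which is a two-element set of vertices.\<close>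

definition cycle_in :: "'v set set \<Rightarrow> 'v list \<Rightarrow> bool" where
  "cycle_in E vs \<longleftrightarrow> 3 \<le> length vs \<and> distinct vs \<and>
     (\<forall>i<length vs. {vs ! i, vs ! (Suc i mod length vs)} \<in> E)"

definition is_forest :: "'v set set \<Rightarrow> bool" where
  "is_forest E \<longleftrightarrow> (\<nexists>vs. cycle_in E vs)"

definition valence :: "'v set set \<Rightarrow> 'v \<Rightarrow> nat" where
  "valence E v = card {e \<in> E. v \<in> e}"


section \<open>Free products of groups\<close>

text \<open>
  The elements of the free product are the reduced words: sequences of nontrivial elements of the
  factors, each letter tagged with its factor, where adjacent letters lie in different factors.
  Multiplication is concatenation followed by reduction.
\<close>

definition reduced_words :: "'i set \<Rightarrow> ('i \<Rightarrow> ('a, 'b) monoid_scheme) \<Rightarrow> ('i \<times> 'a) list set" where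
  "reduced_words I G =
     {w. (\<forall>(i, g) \<in> set w. i \<in> I \<and> g \<in> carrier (G i) \<and> g \<noteq> \<one>\<^bsub>G i\<^esub>) \<and> distinct_adj (map fst w)}"

fun word_cons :: "('i \<Rightarrow> ('a, 'b) monoid_scheme) \<Rightarrow> 'i \<times> 'a \<Rightarrow> ('i \<times> 'a) list \<Rightarrow> ('i \<times> 'a) list" where
  "word_cons G (i, g) [] = (if g = \<one>\<^bsub>G i\<^esub> then [] else [(i, g)])"
| "word_cons G (i, g) ((j, h) # w) =
     (if g = \<one>\<^bsub>G i\<^esub> then (j, h) # w
      else if i \<noteq> j then (i, g) # (j, h) # w
      else if g \<otimes>\<^bsub>G i\<^esub> h = \<one>\<^bsub>G i\<^esub> then w
      else (i, g \<otimes>\<^bsub>G i\<^esub> h) # w)"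

definition free_product :: "'i set \<Rightarrow> ('i \<Rightarrow> ('a, 'b) monoid_scheme) \<Rightarrow> ('i \<times> 'a) list monoid" where
  "free_product I G =
     \<lparr>carrier = reduced_words I G, monoid.mult = (\<lambda>u v. foldr (word_cons G) u v), one = []\<rparr>"

lemma group_free_product:
  assumes grp: "\<And>i. i \<in> I \<Longrightarrow> group (G i)"
  shows "group (free_product I G)"
proof -
  let ?R = "reduced_words I G" and ?c = "word_cons G"
  let ?L = "{(i, g). i \<in> I \<and> g \<in> carrier (G i)}"
  have Cons_R: "(i, g) # w \<in> ?R \<longleftrightarrow> i \<in> I \<and> g \<in> carrier (G i) \<and> g \<noteq> \<one>\<^bsub>G i\<^esub> \<and> w \<in> ?R \<and>
      (w = [] \<or> i \<noteq> fst (hd w))" for i g w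
    by (cases w) (auto simp: reduced_words_def)
  have Nil_R: "[] \<in> ?R" by (simp add: reduced_words_def)
  have sub_L: "set w \<subseteq> ?L" if "w \<in> ?R" for w
    using that by (auto simp: reduced_words_def)
  have cR: "?c x w \<in> ?R" if "x \<in> ?L" "w \<in> ?R" for x w
  proof -
    obtain i g where x: "x = (i, g)" by force
    interpret group "G i" using that x grp by auto
    show ?thesis
    proof (cases w)
      case Nil
      then show ?thesis using that by (auto simp: x Cons_R Nil_R)
    next
      case (Cons y w')
      obtain j h where y: "y = (j, h)" by force
      have "g \<otimes>\<^bsub>G i\<^esub> h \<in> carrier (G i)" if "i = j"
        using that \<open>x \<in> ?L\<close> \<open>w \<in> ?R\<close> Cons by (intro m_closed) (simp_all add: x y Cons_R)
      then show ?thesis using that Cons by (auto simp: x y Cons_R)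
    qed
  qed
  have fR: "foldr ?c u w \<in> ?R" if "set u \<subseteq> ?L" "w \<in> ?R" for u w
    using that by (induction u) (auto intro!: cR)
  have c1: "?c (i, \<one>\<^bsub>G i\<^esub>) w = w" for i w
    by (cases w) auto
  have cc: "?c (i, g) (?c (i, h) w) = ?c (i, g \<otimes>\<^bsub>G i\<^esub> h) w"
    if i: "i \<in> I" and g: "g \<in> carrier (G i)" and h: "h \<in> carrier (G i)" and w: "w \<in> ?R" for i g h w
  proof -
    interpret group "G i" using i grp by auto
    show ?thesis
    proof (cases "g = \<one>\<^bsub>G i\<^esub> \<or> h = \<one>\<^bsub>G i\<^esub>")
      case True
      then show ?thesis using g h by (auto simp: c1)
    next
      case gh: False
      show ?thesis
      proof (cases "w \<noteq> [] \<and> fst (hd w) = i")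
        case False
        then show ?thesis using gh by (cases w) auto
      next
        case True
        then obtain k w' where w': "w = (i, k) # w'" by (cases w) auto
        then have k: "k \<in> carrier (G i)" "k \<noteq> \<one>\<^bsub>G i\<^esub>" and hd': "w' = [] \<or> i \<noteq> fst (hd w')"
          and wR: "w' \<in> ?R"
          using w by (auto simp: Cons_R)
        have c': "?c (i, x) w' = (if x = \<one>\<^bsub>G i\<^esub> then w' else (i, x) # w')" for x
          using hd' by (cases w') auto
        have cw: "?c (i, x) w = ?c (i, x \<otimes>\<^bsub>G i\<^esub> k) w'" if "x \<in> carrier (G i)" for x
          using that k by (auto simp: w' c')
        show ?thesis
        proof (cases "h \<otimes>\<^bsub>G i\<^esub> k = \<one>\<^bsub>G i\<^esub>")
          case True
          then have "g \<otimes>\<^bsub>G i\<^esub> h \<otimes>\<^bsub>G i\<^esub> k = g" using g h k by (simp add: m_assoc)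
          then show ?thesis using g h True by (simp add: cw c1)
        next
          case False
          then have "?c (i, h) w = (i, h \<otimes>\<^bsub>G i\<^esub> k) # w'" using h by (simp add: cw c')
          then show ?thesis using g h k False gh
            by (simp add: cw c' m_assoc)
        qed
      qed
    qed
  qed
  have cf: "foldr ?c (?c x v) w = ?c x (foldr ?c v w)"
    if x: "x \<in> ?L" and v: "v \<in> ?R" and w: "w \<in> ?R" for x v w
  proof -
    obtain i g where xi: "x = (i, g)" by force
    then have ig: "i \<in> I" "g \<in> carrier (G i)" using x by auto
    show ?thesis
    proof (cases v)
      case Nil
      then show ?thesis by (auto simp: xi c1)
    next
      case (Cons y v')
      obtain j h where y: "y = (j, h)" by force
      have jh: "j \<in> I" "h \<in> carrier (G j)" "v' \<in> ?R" using v by (auto simp: Cons y Cons_R)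
      have f': "foldr ?c v' w \<in> ?R" using fR[OF sub_L[OF jh(3)] w] .
      show ?thesis using cc[OF ig, of h, OF _ f'] jh ig
        by (auto simp: Cons y xi c1)
    qed
  qed
  have ff: "foldr ?c (foldr ?c u v) w = foldr ?c u (foldr ?c v w)"
    if u: "set u \<subseteq> ?L" and v: "v \<in> ?R" and w: "w \<in> ?R" for u v w
    using u
  proof (induction u)
    case (Cons x u)
    then show ?case using cf[OF _ fR[of u v] w, of x] v by simp
  qed simp
  have right_one: "foldr ?c u [] = u" if "u \<in> ?R" for u
    using that
  proof (induction u)
    case (Cons x u)
    obtain i g where "x = (i, g)" by force
    with Cons show ?case by (cases u) (auto simp: Cons_R)
  qed simp
  have inv: "\<exists>v. set v \<subseteq> ?L \<and> foldr ?c v u = []" if "u \<in> ?R" for u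
    using that
  proof (induction u)
    case (Cons x u)
    obtain i g where x: "x = (i, g)" by force
    have ig: "i \<in> I" "g \<in> carrier (G i)" "g \<noteq> \<one>\<^bsub>G i\<^esub>" and u: "u \<in> ?R"
      using Cons.prems by (auto simp: x Cons_R)
    interpret group "G i" using ig grp by auto
    obtain v where v: "set v \<subseteq> ?L" "foldr ?c v u = []" using Cons.IH u by blast
    have "?c (i, inv\<^bsub>G i\<^esub> g) (x # u) = u" using ig by (auto simp: x)
    then have "foldr ?c (v @ [(i, inv\<^bsub>G i\<^esub> g)]) (x # u) = []" using v by simp
    moreover have "set (v @ [(i, inv\<^bsub>G i\<^esub> g)]) \<subseteq> ?L" using v ig by auto
    ultimately show ?case by blast
  qed (auto intro: exI[of _ "[]"])
  show ?thesis
  proof (rule groupI)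
    fix u assume u: "u \<in> carrier (free_product I G)"
    then obtain v where v: "set v \<subseteq> ?L" "foldr ?c v u = []"
      using inv by (auto simp: free_product_def)
    have "foldr ?c (foldr ?c v []) u = []" using ff[OF v(1) Nil_R, of u] u v
      by (simp add: free_product_def)
    then show "\<exists>y\<in>carrier (free_product I G).
        y \<otimes>\<^bsub>free_product I G\<^esub> u = \<one>\<^bsub>free_product I G\<^esub>"
      using fR[OF v(1) Nil_R] by (auto simp: free_product_def)
  qed (use fR ff sub_L Nil_R in \<open>auto simp: free_product_def\<close>)
qed


section \<open>The belt-exchange matrices\<close>

definition GL4 :: "(real^4^4) monoid" where
  "GL4 = units_of \<lparr>carrier = UNIV, monoid.mult = (**), one = mat 1\<rparr>"

text \<open>
  These act from the right on the matrix with columns \<open>pi_vec (Cs ! 0), \<dots>, pi_vec (Cs ! 3)\<close> of a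
  tent \<open>Cs\<close>.
\<close>

definition exchange :: "nat \<Rightarrow> real^4^4" where
  "exchange k =
     [vector [vector [0, 1, 0, 0],
              vector [1, 0, 0, 0],
              vector [0, 0, 0, 1],
              vector [0, 0, 1, 0]],
      vector [vector [-2, 0, 0, -1],
              vector [ 3, 0, 1,  2],
              vector [ 0, 1, 0, -1],
              vector [ 3, 0, 0,  2]],
      vector [vector [0, -1,  0, 1],
              vector [0,  2,  3, 0],
              vector [0, -1, -2, 0],
              vector [1,  2,  3, 0]]] ! k"

lemma vector_4:
  "(vector [w, x, y, z] :: 'a::zero^4) $ 1 = w"
  "(vector [w, x, y, z] :: 'a::zero^4) $ 2 = x"
  "(vector [w, x, y, z] :: 'a::zero^4) $ 3 = y"
  "(vector [w, x, y, z] :: 'a::zero^4) $ 4 = z"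
  unfolding vector_def by simp_all

lemma exchange_involution:
  assumes "k < 3"
  shows "exchange k ** exchange k = mat 1"
proof -
  have "k = 0 \<or> k = 1 \<or> k = 2" using assms by auto
  then show ?thesis
    by (auto simp: exchange_def vec_eq_iff matrix_matrix_mult_def mat_def sum_4 forall_4 vector_4
        numeral_2_eq_2)
qed

lemma exchange_in_GL4: "k < 3 \<Longrightarrow> exchange k \<in> carrier GL4"
  unfolding GL4_def units_of_carrier by (auto simp: Units_def intro!: exI[of _ "exchange k"] exchange_involution)

end

theory Submission
  imports Defs "HOL-Computational_Algebra.Polynomial_Factorial"
begin

text \<open>
  The Pedoe products force the relation \<open>p\<^sub>1 + p\<^sub>2 + p\<^sub>3 = 2 (q\<^sub>1 + q\<^sub>2)\<close> between the vectors of the peaks and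
  of the two remaining circles (the base) of a tent, so a belt \<open>{p\<^sub>1, p\<^sub>2, q\<^sub>1, q\<^sub>2}\<close> lies in exactly two tents,
  the second one having base \<open>{p\<^sub>1, p\<^sub>2}\<close> and new peak \<open>2 (p\<^sub>1 + p\<^sub>2) - q\<^sub>1 - q\<^sub>2\<close>. That this vector is again that
  of a Bianchi circle follows from an arithmetic description of Bianchi circles, obtained by Euclidean
  descent in \<open>O_K7\<close>. For a linear functional that is nonnegative on a tent, exchanging a peak whose value is
  below the sum over the base increases that sum and creates a peak whose value exceeds it; the other
  peaks then again have values below it. Hence the sum increases along every walk without backtracking.
  The same argument on row vectors shows that no nonempty reduced word in the matrices is the identity.
\<close>

section \<open>Arithmetic of Bianchi circles\<close>

text \<open>A new peak is at first only a vector of Pedoe norm 1, and the obstacle is to see that it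
  belongs to a Bianchi circle. The vectors of Bianchi circles are the norm 1 vectors in two
  translates of a lattice, told apart by a sign \<open>e\<close>, and an integral combination of
  such vectors may miss both translates. Products modulo 7 decide: -5/2 forces equal signs and -1
  opposite signs. So the two pairs in a belt carry opposite signs, and for this pattern the
  coefficients 2, 2, -1, -1 do land in one of the translates.

  No single height on the graph is used. The functional is adapted to a starting tent, through minus
  the sum of its base vectors, so that all three edges at that tent ascend. For the matrices a
  functional is just the row of its values on four circles, so freeness is proved by linear algebra
  without exhibiting any tent.\<close>

lemma poly_of_int_poly_mult:
  fixes z :: "'a :: comm_ring_1"
  shows "poly (map_poly of_int (p * q)) z = poly (map_poly of_int p) z * poly (map_poly of_int q) z"
proof -
  have add: "map_poly of_int (p + q) = (map_poly of_int p + map_poly of_int q :: 'a poly)" for p q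
    by (rule poly_eqI) (simp add: coeff_map_poly)
  have smult: "map_poly of_int (Polynomial.smult c p) = (Polynomial.smult (of_int c) (map_poly of_int p) :: 'a poly)"
    for c p by (rule poly_eqI) (simp add: coeff_map_poly)
  show ?thesis
    by (induction p) (simp_all add: add smult map_poly_pCons algebra_simps)
qed

lemma poly_of_int_poly_add:
  fixes z :: "'a :: comm_ring_1"
  shows "poly (map_poly of_int (p + q)) z = poly (map_poly of_int p) z + poly (map_poly of_int q) z"
proof -
  have "map_poly of_int (p + q) = (map_poly of_int p + map_poly of_int q :: 'a poly)"
    by (rule poly_eqI) (simp add: coeff_map_poly)
  then show ?thesis by simp
qed

text \<open>By Gauss's lemma the primitive integral quadratic polynomial of \<open>z\<close> is monic.\<close>

lemma algebraic_int_quadratic: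
  assumes "algebraic_int z" "Im z \<noteq> 0" "c2 \<noteq> 0"
    and root: "of_int c0 + of_int c1 * z + of_int c2 * z\<^sup>2 = 0"
  obtains t n :: int where "2 * Re z = of_int t" "(cmod z)\<^sup>2 = of_int n"
proof -
  define e where "e p = poly (map_poly of_int p) z" for p :: "int poly"
  have e_mult: "e (p * q) = e p * e q" and e_add: "e (p + q) = e p + e q" for p q
    by (simp_all add: e_def poly_of_int_poly_mult poly_of_int_poly_add)
  define N where "N = [:c0, c1, c2:]"
  define M where "M = primitive_part N"
  define c where "c = lead_coeff M"
  have N: "N \<noteq> 0" "degree N = 2" using assms(3) by (simp_all add: N_def)
  have "N = [:content N:] * M" by (simp add: M_def)
  moreover have "e N = 0" using root by (simp add: e_def N_def map_poly_pCons power2_eq_square algebra_simps)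
  ultimately have "e [:content N:] * e M = 0" using e_mult by metis
  then have eM: "e M = 0" using N(1) by (simp add: e_def map_poly_pCons)
  have M: "content M = 1" "degree M = 2" "M \<noteq> 0" using N by (auto simp: M_def)
  obtain p where p: "e p = 0" "lead_coeff p = 1"
    using assms(1) unfolding algebraic_int_altdef_ipoly e_def by blast
  have "content p dvd 1" using content_dvd_coeff[of p "degree p"] p(2) by simp
  then have cp: "content p = 1" by (metis is_unit_normalize normalize_content)
  \<comment> \<open>Pseudo-division stays over the integers at the price of the factor
    \<open>c ^ k\<close>. The remainder has degree below 2 and vanishes at the nonreal
    \<open>z\<close>, hence is zero.\<close>
  obtain Q R where QR: "pseudo_divmod p M = (Q, R)" by fastforce
  define k where "k = Suc (degree p) - degree M"
  note pd = pseudo_divmod[OF M(3) QR]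
  have eq: "Polynomial.smult (c ^ k) p = M * Q + R" using pd(1) by (simp add: c_def k_def)
  have "degree R < 2" using pd(2) M(2) by auto
  then obtain r0 r1 where R: "R = [:r0, r1:]"
    by (metis One_nat_def Suc_1 degree_eq_zeroE degree_pCons_eq_if less_Suc_eq less_one pCons_cases
        not_less_eq pCons_eq_0_iff)
  have "e (Polynomial.smult (c ^ k) p) = e ([:c ^ k:] * p)" by simp
  also have "\<dots> = 0" using p(1) by (simp only: e_mult) simp
  finally have "e R = 0" unfolding eq e_add e_mult eM by simp
  then have r: "of_int r0 + of_int r1 * z = 0"
    by (simp add: R e_def map_poly_pCons mult.commute)
  have "r1 = 0" using arg_cong[OF r, of Im] assms(2) by simp
  with r have "R = 0" by (simp add: R)
  then have eq': "Polynomial.smult (c ^ k) p = M * Q" using eq by simp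
  have c0: "c \<noteq> 0" using M(3) by (simp add: c_def)
  have "normalize (c ^ k) * content p = content M * content Q"
    using arg_cong[OF eq', of content] by (simp only: content_smult content_mult)
  then have cQ: "content Q = \<bar>c ^ k\<bar>" using cp M(1) by simp
  \<comment> \<open>The content of \<open>Q\<close> contains the full power \<open>c ^ k\<close>, so
    comparing leading coefficients forces |c| = 1: the quadratic is monic up to sign.\<close>
  obtain Q' where "Q = Polynomial.smult (content Q) Q'"
    by (metis content_times_primitive_part)
  then have "c ^ k = c * (\<bar>c ^ k\<bar> * lead_coeff Q')"
    using arg_cong[OF eq', of lead_coeff] p(2) cQ
    by (metis c_def lead_coeff_mult lead_coeff_smult mult.right_neutral)
  then have "\<bar>c ^ k\<bar> * 1 = \<bar>c ^ k\<bar> * (\<bar>c\<bar> * \<bar>lead_coeff Q'\<bar>)"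
    by (metis abs_abs abs_mult mult.left_commute mult.right_neutral)
  then have "\<bar>c\<bar> * \<bar>lead_coeff Q'\<bar> = 1" using c0 by simp
  then have "\<bar>c\<bar> = 1" using zmult_eq_1_iff[of "\<bar>c\<bar>"] by auto
  then have c1: "real_of_int c * real_of_int c = 1" by (auto simp: abs_if split: if_splits)
  obtain m0 m1 m2 where M': "M = [:m0, m1, m2:]"
    using M(2) by (metis One_nat_def Suc_1 degree_eq_zeroE degree_pCons_eq_if nat.inject
        old.nat.distinct(2) pCons_cases)
  have "c = coeff M 2" using M(2) by (simp add: c_def)
  then have m2: "m2 = c" by (simp add: M' numeral_2_eq_2)
  have "of_int m0 + of_int m1 * z + of_int c * z\<^sup>2 = 0"
    using eM by (simp add: e_def M' m2 map_poly_pCons power2_eq_square algebra_simps)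
  from arg_cong[OF this, of Re] arg_cong[OF this, of Im]
  have re: "of_int m0 + of_int m1 * Re z + of_int c * ((Re z)\<^sup>2 - (Im z)\<^sup>2) = 0"
    and "Im z * (of_int m1 + 2 * of_int c * Re z) = 0"
    by (simp_all add: power2_eq_square algebra_simps)
  then have m1: "of_int m1 = - 2 * of_int c * Re z" using assms(2) by simp
  have "2 * Re z = of_int (- c * m1)" using c1 by (simp add: m1 mult.assoc[symmetric])
  moreover have "(cmod z)\<^sup>2 = of_int (c * m0)"
  proof -
    have "of_int m0 = of_int c * ((Re z)\<^sup>2 + (Im z)\<^sup>2)"
      using re unfolding m1 by (simp add: power2_eq_square algebra_simps)
    then show ?thesis using c1 by (simp add: cmod_power2 mult.assoc[symmetric])
  qed
  ultimately show ?thesis using that by blast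
qed

text \<open>The element u + w \<omega> with \<omega> = (1 + sqrt(-7)) / 2, a root of X^2 - X + 2;
  its norm is u^2 + u w + 2 w^2.\<close>

definition ok7 :: "int \<Rightarrow> int \<Rightarrow> complex" where
  "ok7 u w = Complex (u + w / 2) (sqrt 7 * w / 2)"

lemma ok7_sel [simp]: "Re (ok7 u w) = u + w / 2" "Im (ok7 u w) = sqrt 7 * w / 2"
  by (simp_all add: ok7_def)

lemma sqrt7_sqr: "sqrt 7 * sqrt 7 = 7" "sqrt 7 * (sqrt 7 * x) = 7 * x"
  by (simp_all add: mult.assoc[symmetric])

lemma ok7_in_O_K7: "ok7 u w \<in> O_K7"
proof -
  let ?p = "[:of_int (u\<^sup>2 + u * w + 2 * w\<^sup>2), of_int (- (2 * u + w)), 1:] :: complex poly"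
  have "ok7 u w = of_rat (of_int u + of_int w / 2) + of_rat (of_int w / 2) * (\<i> * of_real (sqrt 7))"
    by (simp add: complex_eq_iff of_rat_add of_rat_divide)
  then have "ok7 u w \<in> K7" unfolding K7_def by blast
  moreover have "algebraic_int (ok7 u w)"
  proof (rule algebraic_int.intros)
    show "poly ?p (ok7 u w) = 0"
      by (simp add: complex_eq_iff power2_eq_square algebra_simps sqrt7_sqr)
    show "\<forall>i. coeff ?p i \<in> \<int>"
      by (auto simp: coeff_pCons split: nat.splits)
  qed simp
  ultimately show ?thesis by (simp add: O_K7_def)
qed

lemma O_K7_iff: "z \<in> O_K7 \<longleftrightarrow> (\<exists>u w. z = ok7 u w)"
proof
  assume "z \<in> O_K7"
  then obtain p q where z: "z = of_rat p + of_rat q * (\<i> * of_real (sqrt 7))" and alg: "algebraic_int z"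
    by (auto simp: O_K7_def K7_def)
  have of_rat: "Re (of_rat r) = of_rat r" "Im (of_rat r) = 0" for r :: rat
    by (cases r; simp add: of_rat_divide Fract_of_int_quotient complex_is_Real_iff[symmetric])+
  have Re: "Re z = of_rat p" and Im: "Im z = of_rat q * sqrt 7"
    by (simp_all add: z of_rat)
  show "\<exists>u w. z = ok7 u w"
  proof (cases "q = 0")
    case True
    then have "z = of_rat p" by (simp add: z)
    then have "z \<in> \<int>" using alg by (intro rational_algebraic_int_is_int) simp_all
    then obtain u where "z = of_int u" by (auto elim: Ints_cases)
    then have "z = ok7 u 0" by (simp add: complex_eq_iff)
    then show ?thesis by blast
  next
    case False
    obtain a b where p: "p = of_int a / of_int b" "b > 0" by (metis Fract_of_int_quotient Rat_cases)
    obtain c d where q: "q = of_int c / of_int d" "d > 0" by (metis Fract_of_int_quotient Rat_cases)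
    \<comment> \<open>This is z^2 - 2 p z + p^2 + 7 q^2, multiplied by (b d)^2 to clear
      denominators.\<close>
    have "of_int ((a * d)\<^sup>2 + 7 * (b * c)\<^sup>2) + of_int (- 2 * a * b * d\<^sup>2) * z + of_int ((b * d)\<^sup>2) * z\<^sup>2 = 0"
    proof -
      have "(real_of_int b * Re z) = a" "real_of_int d * Im z = c * sqrt 7"
        using p q by (simp_all add: Re Im of_rat_divide)
      then have *: "real_of_int a = b * Re z" "real_of_int d * Im z = c * sqrt 7" by simp_all
      have 7: "7 * (real_of_int b * c)\<^sup>2 = (b * d * Im z)\<^sup>2"
        using *(2) by (simp add: power_mult_distrib mult.assoc)
      show ?thesis
        using 7 by (simp add: complex_eq_iff *(1) power2_eq_square algebra_simps)
    qed
    moreover have "Im z \<noteq> 0" using False by (simp add: Im)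
    moreover have "(b * d)\<^sup>2 \<noteq> 0" using p q by simp
    ultimately obtain t n where t: "2 * Re z = of_int t" and n: "(cmod z)\<^sup>2 = of_int n"
      using algebraic_int_quadratic[OF alg] by blast
    have s: "7 * (2 * of_rat q)\<^sup>2 = real_of_int (4 * n - t\<^sup>2)"
    proof -
      have "4 * (cmod z)\<^sup>2 = (2 * Re z)\<^sup>2 + 7 * (2 * of_rat q)\<^sup>2"
        by (simp add: cmod_power2 Im power_mult_distrib)
      then show ?thesis using n t by simp
    qed
    \<comment> \<open>The factor 7 turns 7 (2 q)^2 = 4 n - t^2 into a monic integral equation for
      \<open>x\<close>, so the rational \<open>x\<close> is an integer. Primality of 7 then makes 2
      q itself an integer.\<close>
    define x where "x = 7 * (2 * (of_rat q :: real))"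
    have x2: "x\<^sup>2 = of_int (7 * (4 * n - t\<^sup>2))" using s by (simp add: x_def power2_eq_square)
    have "algebraic_int x"
    proof (rule algebraic_int.intros)
      show "poly [:- of_int (7 * (4 * n - t\<^sup>2)), 0, 1:] x = 0"
        using x2 by (simp add: power2_eq_square)
      show "\<forall>i. coeff [:- real_of_int (7 * (4 * n - t\<^sup>2)), 0, 1:] i \<in> \<int>"
        by (auto simp: coeff_pCons split: nat.splits)
    qed simp
    moreover have "x \<in> \<rat>" by (simp add: x_def)
    ultimately have "x \<in> \<int>" by (rule rational_algebraic_int_is_int)
    then obtain k where k: "x = of_int k" by (auto elim: Ints_cases)
    then have "k\<^sup>2 = 7 * (4 * n - t\<^sup>2)" using x2 by (metis of_int_eq_iff of_int_power)
    then have "7 dvd k\<^sup>2" by simp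
    moreover have "prime (7 :: int)" by simp
    ultimately have "7 dvd k" by (metis prime_dvd_power)
    then obtain w where w: "k = 7 * w" by blast
    then have qw: "2 * of_rat q = real_of_int w" using k by (simp add: x_def)
    have "7 * w\<^sup>2 = 4 * n - t\<^sup>2" using s unfolding qw by (metis of_int_eq_iff of_int_mult of_int_numeral of_int_power)
    then have "even (7 * w\<^sup>2 + t\<^sup>2)" by simp
    then have "even (t - w)" by simp
    then obtain u where "t = w + 2 * u" by (metis add_diff_cancel_left' dvdE diff_add_cancel add.commute)
    then have "z = ok7 u w"
      using t qw by (simp add: complex_eq_iff Im field_simps)
    then show ?thesis by blast
  qed
qed (use ok7_in_O_K7 in blast)

lemma ok7_add: "ok7 u w + ok7 u' w' = ok7 (u + u') (w + w')"
  by (simp add: complex_eq_iff field_simps)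

lemma ok7_mult: "ok7 u w * ok7 u' w' = ok7 (u * u' - 2 * w * w') (u * w' + w * u' + w * w')"
  by (simp add: complex_eq_iff field_simps sqrt7_sqr)

section \<open>Moebius maps in homogeneous coordinates\<close>

lemma ratio_scale: "k \<noteq> 0 \<Longrightarrow> ratio (k * X) (k * Y) = ratio X Y"
  by (simp add: ratio_def)

text \<open>Homogeneous coordinates treat infinity like every other point, so that composition of
  maps and substitution into the Hermitian form become linear algebra.\<close>

lemma moebius_map_ratio:
  assumes "(X, Y) \<noteq> (0, 0)"
  shows "moebius_map M (ratio X Y) = ratio (M$1$1 * X + M$1$2 * Y) (M$2$1 * X + M$2$2 * Y)"
proof (cases "Y = 0")
  case True
  then have "X \<noteq> 0" using assms by simp
  then show ?thesis using True ratio_scale[of X "M$1$1" "M$2$1"]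
    by (simp add: moebius_map_def ratio_def[of X 0] mult.commute)
next
  case False
  then show ?thesis
    using ratio_scale[of Y "M$1$1 * (X / Y) + M$1$2" "M$2$1 * (X / Y) + M$2$2"]
    by (simp add: moebius_map_def ratio_def[of X Y] algebra_simps)
qed

lemma ratio_surj: obtains X Y where "(X, Y) \<noteq> (0, 0)" "p = ratio X Y"
proof (cases p)
  case None
  then show ?thesis using that[of 1 0] by (simp add: ratio_def)
next
  case (Some z)
  then show ?thesis using that[of z 1] by (simp add: ratio_def)
qed

lemma unimodular_nonzero:
  fixes \<alpha> \<beta> \<gamma> \<delta> X Y :: complex
  assumes "\<alpha> * \<delta> - \<beta> * \<gamma> = 1" "(X, Y) \<noteq> (0, 0)"
  shows "(\<alpha> * X + \<beta> * Y, \<gamma> * X + \<delta> * Y) \<noteq> (0, 0)"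
proof
  assume "(\<alpha> * X + \<beta> * Y, \<gamma> * X + \<delta> * Y) = (0, 0)"
  then have 0: "\<alpha> * X + \<beta> * Y = 0" "\<gamma> * X + \<delta> * Y = 0" by simp_all
  have "(\<alpha> * \<delta> - \<beta> * \<gamma>) * X = \<delta> * (\<alpha> * X + \<beta> * Y) - \<beta> * (\<gamma> * X + \<delta> * Y)"
    "(\<alpha> * \<delta> - \<beta> * \<gamma>) * Y = \<alpha> * (\<gamma> * X + \<delta> * Y) - \<gamma> * (\<alpha> * X + \<beta> * Y)"
    by (simp_all add: algebra_simps)
  then show False using assms 0 by simp
qed

lemma moebius_map_mult:
  assumes "det N = 1"
  shows "moebius_map M (moebius_map N p) = moebius_map (M ** N) p"
proof -
  obtain X Y where p: "(X, Y) \<noteq> (0, 0)" "p = ratio X Y" by (rule ratio_surj)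
  have nz: "(N$1$1 * X + N$1$2 * Y, N$2$1 * X + N$2$2 * Y) \<noteq> (0, 0)"
    using unimodular_nonzero[OF _ p(1)] assms by (simp add: det_2)
  show ?thesis
    unfolding p(2) moebius_map_ratio[OF p(1)] moebius_map_ratio[OF nz]
    by (simp add: matrix_matrix_mult_def sum_2 algebra_simps)
qed

lemma SL2_O_K7_mult:
  assumes "M \<in> SL2_O_K7" "N \<in> SL2_O_K7"
  shows "M ** N \<in> SL2_O_K7"
proof -
  have add: "x + y \<in> O_K7" and mult: "x * y \<in> O_K7" if "x \<in> O_K7" "y \<in> O_K7" for x y
    using that ok7_add ok7_mult unfolding O_K7_iff by metis+
  have "(M ** N) $ i $ j \<in> O_K7" for i j
    using assms by (auto simp: SL2_O_K7_def matrix_matrix_mult_def sum_2 intro!: add mult)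
  then show ?thesis using assms by (simp add: SL2_O_K7_def det_mul)
qed

lemma bianchi_circle_moebius:
  assumes "bianchi_circle S" "M \<in> SL2_O_K7"
  shows "bianchi_circle (moebius_map M ` S)"
proof -
  obtain N where N: "N \<in> SL2_O_K7" "S = moebius_map N ` real_line"
    using assms(1) unfolding bianchi_circle_def by blast
  then have "moebius_map M ` S = moebius_map (M ** N) ` real_line"
    by (simp add: image_image moebius_map_mult SL2_O_K7_def)
  then show ?thesis using SL2_O_K7_mult[OF assms(2) N(1)] unfolding bianchi_circle_def by blast
qed

definition mat2 :: "'a::zero \<Rightarrow> 'a \<Rightarrow> 'a \<Rightarrow> 'a \<Rightarrow> 'a^2^2" where
  "mat2 \<alpha> \<beta> \<gamma> \<delta> = vector [vector [\<alpha>, \<beta>], vector [\<gamma>, \<delta>]]"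

lemma mat2_sel [simp]:
  "mat2 \<alpha> \<beta> \<gamma> \<delta> $ 1 $ 1 = \<alpha>" "mat2 \<alpha> \<beta> \<gamma> \<delta> $ 1 $ 2 = \<beta>"
  "mat2 \<alpha> \<beta> \<gamma> \<delta> $ 2 $ 1 = \<gamma>" "mat2 \<alpha> \<beta> \<gamma> \<delta> $ 2 $ 2 = \<delta>"
  by (simp_all add: mat2_def)

lemma mat2_collapse: "mat2 (M$1$1) (M$1$2) (M$2$1) (M$2$2) = M"
  by (simp add: vec_eq_iff forall_2)

lemma mat2_SL2_O_K7:
  "mat2 (ok7 u1 w1) (ok7 u2 w2) (ok7 u3 w3) (ok7 u4 w4) \<in> SL2_O_K7 \<longleftrightarrow>
    ok7 u1 w1 * ok7 u4 w4 - ok7 u2 w2 * ok7 u3 w3 = 1"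
  by (simp add: SL2_O_K7_def forall_2 det_2 ok7_in_O_K7)

text \<open>The image data come from substituting \<open>M\<^sup>-\<^sup>1 (X, Y) = (\<delta> X - \<beta> Y, \<alpha> Y - \<gamma> X)\<close> into the Hermitian form.\<close>

lemma moebius_circle_locus:
  assumes det: "\<alpha> * \<delta> - \<beta> * \<gamma> = 1"
  shows "moebius_map (mat2 \<alpha> \<beta> \<gamma> \<delta>) ` circle_locus b' b a =
    circle_locus
      (b * (cmod \<beta>)\<^sup>2 + 2 * Re (a * \<alpha> * cnj \<beta>) + b' * (cmod \<alpha>)\<^sup>2)
      (b * (cmod \<delta>)\<^sup>2 + 2 * Re (a * \<gamma> * cnj \<delta>) + b' * (cmod \<gamma>)\<^sup>2)
      (of_real b * \<beta> * cnj \<delta> + a * \<alpha> * cnj \<delta> + cnj a * \<beta> * cnj \<gamma> + of_real b' * \<alpha> * cnj \<gamma>)"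
    (is "?lhs = circle_locus ?c' ?c ?d")
proof -
  have form: "circle_form ?c' ?c ?d X Y = circle_form b' b a (\<delta> * X - \<beta> * Y) (\<alpha> * Y - \<gamma> * X)" for X Y
  proof -
    have c': "complex_of_real ?c' = of_real b * (\<beta> * cnj \<beta>) + (a * \<alpha> * cnj \<beta> + cnj a * cnj \<alpha> * \<beta>)
        + of_real b' * (\<alpha> * cnj \<alpha>)"
      using complex_add_cnj[of "a * \<alpha> * cnj \<beta>"] by (simp add: complex_norm_square del: of_real_power)
    have c: "complex_of_real ?c = of_real b * (\<delta> * cnj \<delta>) + (a * \<gamma> * cnj \<delta> + cnj a * cnj \<gamma> * \<delta>)
        + of_real b' * (\<gamma> * cnj \<gamma>)"
      using complex_add_cnj[of "a * \<gamma> * cnj \<delta>"] by (simp add: complex_norm_square del: of_real_power)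
    show ?thesis
      unfolding circle_form_def c c' by (simp add: algebra_simps)
  qed
  have inv: "\<delta> * (\<alpha> * X + \<beta> * Y) - \<beta> * (\<gamma> * X + \<delta> * Y) = X"
    "\<alpha> * (\<gamma> * X + \<delta> * Y) - \<gamma> * (\<alpha> * X + \<beta> * Y) = Y"
    "\<alpha> * (\<delta> * X - \<beta> * Y) + \<beta> * (\<alpha> * Y - \<gamma> * X) = X"
    "\<gamma> * (\<delta> * X - \<beta> * Y) + \<delta> * (\<alpha> * Y - \<gamma> * X) = Y" for X Y
  proof -
    have "(\<alpha> * \<delta> - \<beta> * \<gamma>) * X = X" "(\<alpha> * \<delta> - \<beta> * \<gamma>) * Y = Y" using det by simp_all
    then show "\<delta> * (\<alpha> * X + \<beta> * Y) - \<beta> * (\<gamma> * X + \<delta> * Y) = X"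
      "\<alpha> * (\<gamma> * X + \<delta> * Y) - \<gamma> * (\<alpha> * X + \<beta> * Y) = Y"
      "\<alpha> * (\<delta> * X - \<beta> * Y) + \<beta> * (\<alpha> * Y - \<gamma> * X) = X"
      "\<gamma> * (\<delta> * X - \<beta> * Y) + \<delta> * (\<alpha> * Y - \<gamma> * X) = Y"
      by (simp_all add: algebra_simps)
  qed
  have det': "\<delta> * \<alpha> - (- \<beta>) * (- \<gamma>) = 1" using det by (simp add: mult.commute)
  show ?thesis
  proof (rule equalityI; rule subsetI)
    fix p assume "p \<in> ?lhs"
    then obtain X Y where XY: "(X, Y) \<noteq> (0, 0)" "circle_form b' b a X Y = 0"
      "p = moebius_map (mat2 \<alpha> \<beta> \<gamma> \<delta>) (ratio X Y)"
      unfolding circle_locus_def by blast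
    have "p = ratio (\<alpha> * X + \<beta> * Y) (\<gamma> * X + \<delta> * Y)"
      using XY(3) by (simp add: moebius_map_ratio[OF XY(1)])
    moreover have "circle_form ?c' ?c ?d (\<alpha> * X + \<beta> * Y) (\<gamma> * X + \<delta> * Y) = 0"
      unfolding form inv by (rule XY(2))
    ultimately show "p \<in> circle_locus ?c' ?c ?d"
      unfolding circle_locus_def using unimodular_nonzero[OF det XY(1)] by blast
  next
    fix p assume "p \<in> circle_locus ?c' ?c ?d"
    then obtain X Y where XY: "(X, Y) \<noteq> (0, 0)" "circle_form ?c' ?c ?d X Y = 0" "p = ratio X Y"
      unfolding circle_locus_def by blast
    let ?X = "\<delta> * X - \<beta> * Y" and ?Y = "\<alpha> * Y - \<gamma> * X"
    have nz: "(?X, ?Y) \<noteq> (0, 0)"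
      using unimodular_nonzero[OF det' XY(1)] by (simp add: algebra_simps)
    have "p = moebius_map (mat2 \<alpha> \<beta> \<gamma> \<delta>) (ratio ?X ?Y)"
      by (simp only: moebius_map_ratio[OF nz] mat2_sel inv XY(3))
    moreover have "ratio ?X ?Y \<in> circle_locus b' b a"
      using nz XY(2) unfolding form circle_locus_def by blast
    ultimately show "p \<in> ?lhs" by blast
  qed
qed

section \<open>Lattice data of Bianchi circles\<close>

lemma circle_locus_minus: "circle_locus (- b') (- b) (- a) = circle_locus b' b a"
proof -
  have "circle_form (- b') (- b) (- a) X Y = - circle_form b' b a X Y" for X Y
    by (simp add: circle_form_def algebra_simps)
  then show ?thesis by (simp add: circle_locus_def)
qed

lemma real_line_circle_locus: "real_line = circle_locus 0 0 \<i>"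
  unfolding circle_locus_line real_line_def
  by (auto simp: inner_complex_def complex_is_Real_iff)

text \<open>
  The circle data with \<open>b\<close> and \<open>b'\<close> in \<open>sqrt 7 \<int>\<close> and \<open>a = \<i> (e - sqrt(-7) \<zeta>)\<close>, where \<open>\<zeta> = ok7 u w\<close>; the
  Bianchi circles are those with \<open>e = 1\<close> or \<open>e = -1\<close>, depending on the orientation.
\<close>

definition lattice_normal :: "int \<Rightarrow> int \<Rightarrow> int \<Rightarrow> complex" where
  "lattice_normal e u w =
     Complex (sqrt 7 * (real_of_int u + real_of_int w / 2)) (real_of_int e + 7 * real_of_int w / 2)"

lemma lattice_normal_sel [simp]:
  "Re (lattice_normal e u w) = sqrt 7 * (real_of_int u + real_of_int w / 2)"
  "Im (lattice_normal e u w) = real_of_int e + 7 * real_of_int w / 2"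
  by (simp_all add: lattice_normal_def)

definition lattice_vec :: "int \<Rightarrow> int \<Rightarrow> int \<Rightarrow> int \<Rightarrow> int \<Rightarrow> real^4" where
  "lattice_vec e m n u w = vector [sqrt 7 * real_of_int m, sqrt 7 * real_of_int n,
     Re (lattice_normal e u w), Im (lattice_normal e u w)]"

definition sqrt7_lattice :: "int \<Rightarrow> (real^4) set" where
  "sqrt7_lattice e = {lattice_vec e m n u w | m n u w. True}"

definition lattice_locus :: "int \<Rightarrow> int \<Rightarrow> int \<Rightarrow> int \<Rightarrow> int \<Rightarrow> sphere_pt set" where
  "lattice_locus e m n u w =
     circle_locus (sqrt 7 * real_of_int m) (sqrt 7 * real_of_int n) (lattice_normal e u w)"

text \<open>The normal is e \<i> + sqrt 7 \<zeta>, and translation by \<tau> =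
  \<open>ok7 s t\<close> adds b \<tau> = sqrt 7 n \<tau> to it, so \<zeta> becomes \<zeta> + n
  \<tau>. The new \<open>m\<close> collects n |\<tau>|^2, the trace of \<zeta> cnj \<tau>, and e t
  from the summand e \<i>.\<close>

lemma moebius_translate_lattice_locus:
  "moebius_map (mat2 1 (ok7 s t) 0 1) ` lattice_locus e m n u w =
    lattice_locus e (n * (s\<^sup>2 + s * t + 2 * t\<^sup>2) + 2 * u * s + u * t + w * s + 4 * w * t + e * t + m) n
      (u + n * s) (w + n * t)" (is "_ = lattice_locus e ?m n ?u ?w")
proof -
  have "(cmod (ok7 s t))\<^sup>2 = of_int (s\<^sup>2 + s * t + 2 * t\<^sup>2)"
    unfolding cmod_power2 by (simp add: power2_eq_square algebra_simps add_divide_distrib sqrt7_sqr)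
  moreover have "2 * Re (lattice_normal e u w * cnj (ok7 s t)) =
      sqrt 7 * of_int (2 * u * s + u * t + w * s + 4 * w * t + e * t)"
    by (simp add: algebra_simps add_divide_distrib sqrt7_sqr)
  ultimately have "sqrt 7 * n * (cmod (ok7 s t))\<^sup>2 + 2 * Re (lattice_normal e u w * cnj (ok7 s t)) + sqrt 7 * m
      = sqrt 7 * real_of_int ?m"
    by (simp add: algebra_simps)
  moreover have "of_real (sqrt 7 * n) * ok7 s t + lattice_normal e u w = lattice_normal e ?u ?w"
    by (simp add: complex_eq_iff algebra_simps sqrt7_sqr add_divide_distrib)
  ultimately show ?thesis
    unfolding lattice_locus_def by (subst moebius_circle_locus) simp_all
qed

text \<open>The map z -> -1/z exchanges b and b' and replaces a by -cnj a. Conjugation sends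
  \<omega> to 1 - \<omega>, whence the coordinates -u - w and w.\<close>

lemma moebius_invert_lattice_locus:
  "moebius_map (mat2 0 (- 1) 1 0) ` lattice_locus e m n u w = lattice_locus e n m (- u - w) w"
proof -
  have "- cnj (lattice_normal e u w) = lattice_normal e (- u - w) w"
    by (simp add: complex_eq_iff algebra_simps)
  then show ?thesis
    unfolding lattice_locus_def by (subst moebius_circle_locus) simp_all
qed

lemma lattice_norm_form:
  fixes u w e :: int
  assumes "e \<in> {1, -1}"
  shows "7 * real_of_int (u\<^sup>2 + u * w + 2 * w\<^sup>2 + e * w) =
    7 * (u + w / 2)\<^sup>2 + (e + 7 * w / 2)\<^sup>2 - 1"
  using assms by (auto simp: power2_eq_square algebra_simps add_divide_distrib)

text \<open>This settles the lines: for n = 0 only the normals \<i> and -\<i> remain. After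
  completing the square, w (7 w + 4 e) is positive for every nonzero integer w because |7 w| >
  4.\<close>

lemma lattice_norm_form_eq_0:
  fixes u w e :: int
  assumes "e \<in> {1, -1}" "u\<^sup>2 + u * w + 2 * w\<^sup>2 + e * w = 0"
  shows "u = 0" "w = 0"
proof -
  have "4 * (u\<^sup>2 + u * w + 2 * w\<^sup>2 + e * w) = (2 * u + w)\<^sup>2 + w * (7 * w + 4 * e)"
    by (simp add: power2_eq_square algebra_simps)
  then have *: "(2 * u + w)\<^sup>2 + w * (7 * w + 4 * e) = 0" using assms(2) by simp
  show "w = 0"
  proof (rule ccontr)
    assume "w \<noteq> 0"
    then have "w * (7 * w + 4 * e) > 0"
      using assms(1) by (auto simp: zero_less_mult_iff) presburger+
    then show False using * zero_le_power2[of "2 * u + w"] by linarith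
  qed
  then show "u = 0" using assms(2) by simp
qed

text \<open>
  Euclidean descent: translating the centre \<open>a / b\<close> of the circle to within distance \<open>\<surd>(11/16) < 1\<close> of the
  origin makes \<open>b'\<close> smaller than \<open>b\<close>, and inversion exchanges the two.
\<close>

lemma bianchi_lattice_locus:
  assumes "e \<in> {1, -1}" "m * n = u\<^sup>2 + u * w + 2 * w\<^sup>2 + e * w"
  shows "bianchi_circle (lattice_locus e m n u w)"
  using assms(2)
proof (induction "nat \<bar>n\<bar>" arbitrary: m n u w rule: less_induct)
  case less
  have one: "1 = ok7 1 0" "0 = ok7 0 0" "- 1 = ok7 (-1) 0" by (simp_all add: complex_eq_iff)
  have translate: "mat2 1 (ok7 s t) 0 1 \<in> SL2_O_K7" for s t
    by (simp add: SL2_O_K7_def forall_2 det_2 ok7_in_O_K7 one(1)) (simp add: ok7_in_O_K7 one)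
  have invert: "mat2 0 (- 1) 1 0 \<in> SL2_O_K7"
    by (simp add: SL2_O_K7_def forall_2 det_2) (metis ok7_in_O_K7 one)
  show ?case
  proof (cases "n = 0")
    case True
    then have "u\<^sup>2 + u * w + 2 * w\<^sup>2 + e * w = 0" using less.prems by simp
    then have uw: "u = 0" "w = 0" by (rule lattice_norm_form_eq_0[OF assms(1)])+
    have "lattice_normal 1 0 0 = \<i>" "lattice_normal (- 1) 0 0 = - \<i>"
      by (simp_all add: complex_eq_iff)
    moreover have "circle_locus 0 0 (- \<i>) = circle_locus 0 0 \<i>"
      using circle_locus_minus[of 0 0 \<i>] by simp
    ultimately have "circle_locus 0 0 (lattice_normal e 0 0) = circle_locus 0 0 \<i>"
      using assms(1) by (metis insertE singletonD)
    then have line: "real_line = lattice_locus e 0 0 0 0"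
      by (simp add: real_line_circle_locus lattice_locus_def)
    have em: "e * (e * m) = m" using assms(1) by auto
    \<comment> \<open>Translating this line by t \<omega> raises \<open>m\<close> by e t, and t = e
      m gives e^2 m = m.\<close>
    have "lattice_locus e m n u w = moebius_map (mat2 1 (ok7 0 (e * m)) 0 1) ` real_line"
      unfolding line moebius_translate_lattice_locus by (simp add: True uw em)
    then show ?thesis using translate unfolding bianchi_circle_def by blast
  next
    case False
    \<comment> \<open>\<open>t\<close> comes first because only it moves the imaginary part of the
      normal, in steps of 7 n / 2. Then \<open>s\<close> moves the real part in steps of sqrt 7 n,
      starting from the \<open>w'\<close> that \<open>t\<close> has produced.\<close>
    define t where "t = round (- (e + 7 * w / 2) / (7 * n / 2))"
    define w' where "w' = w + n * t"
    define s where "s = round (- (u + w' / 2) / n)"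
    define u' where "u' = u + n * s"
    define m' where "m' = n * (s\<^sup>2 + s * t + 2 * t\<^sup>2) + 2 * u * s + u * t + w * s + 4 * w * t + e * t + m"
    have step: "moebius_map (mat2 1 (ok7 s t) 0 1) ` lattice_locus e m n u w = lattice_locus e m' n u' w'"
      by (simp add: moebius_translate_lattice_locus m'_def u'_def w'_def)
    have m'n: "m' * n = u'\<^sup>2 + u' * w' + 2 * w'\<^sup>2 + e * w'"
    proof -
      have "m' * n = n * (n * (s\<^sup>2 + s * t + 2 * t\<^sup>2) + 2 * u * s + u * t + w * s + 4 * w * t + e * t) + m * n"
        by (simp add: m'_def algebra_simps)
      then show ?thesis
        unfolding less.prems u'_def w'_def by (simp add: power2_eq_square algebra_simps)
    qed
    have "\<bar>t - (- (e + 7 * w / 2) / (7 * n / 2))\<bar> \<le> 1/2"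
      unfolding t_def by (rule of_int_round_abs_le)
    moreover have "e + 7 * w' / 2 = (t - (- (e + 7 * w / 2) / (7 * n / 2))) * (7 * n / 2)"
      using False by (simp add: w'_def field_simps)
    ultimately have 1: "\<bar>e + 7 * w' / 2\<bar> \<le> 1/2 * \<bar>7 * n / 2\<bar>"
      by (simp only: abs_mult) (rule mult_right_mono; simp)
    have "\<bar>s - (- (u + w' / 2) / n)\<bar> \<le> 1/2"
      unfolding s_def by (rule of_int_round_abs_le)
    moreover have "u' + w' / 2 = (s - (- (u + w' / 2) / n)) * n"
      using False by (simp add: u'_def field_simps)
    ultimately have 2: "\<bar>u' + w' / 2\<bar> \<le> 1/2 * \<bar>real_of_int n\<bar>"
      by (simp only: abs_mult) (rule mult_right_mono; simp)
    have "(e + 7 * w' / 2)\<^sup>2 \<le> 49/16 * (real_of_int n)\<^sup>2"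
      using power_mono[OF 1, of 2] by (simp add: power_mult_distrib power_divide)
    moreover have "(u' + w' / 2)\<^sup>2 \<le> 1/4 * (real_of_int n)\<^sup>2"
      using power_mono[OF 2, of 2] by (simp add: power_mult_distrib power_divide)
    moreover have nf: "7 * real_of_int (m' * n) = 7 * (u' + w' / 2)\<^sup>2 + (e + 7 * w' / 2)\<^sup>2 - 1"
      unfolding m'n by (rule lattice_norm_form[OF assms(1)])
    moreover have "(real_of_int n)\<^sup>2 \<ge> 0" by simp
    \<comment> \<open>The bounds give 7 m' n \<le> (7/4 + 49/16) n^2 - 1, and 77/16 < 7.\<close>
    ultimately have "real_of_int (m' * n) < (real_of_int n)\<^sup>2" by linarith
    then have upper: "m' * n < n * n" by (metis of_int_less_iff of_int_power power2_eq_square)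
    \<comment> \<open>For an integer, 7 m' n \<ge> -1 already means m' n \<ge> 0, so the upper bound
      on m' n becomes a bound on |m'|.\<close>
    have "7 * real_of_int (m' * n) \<ge> - 1" unfolding nf by simp
    then have "7 * (m' * n) \<ge> - 1" by linarith
    then have "m' * n \<ge> 0" by linarith
    then have "\<bar>m'\<bar> * \<bar>n\<bar> < \<bar>n\<bar> * \<bar>n\<bar>" using upper by (simp add: abs_mult[symmetric])
    then have "\<bar>m'\<bar> < \<bar>n\<bar>" by (rule mult_right_less_imp_less) simp
    then have "nat \<bar>m'\<bar> < nat \<bar>n\<bar>" using False by simp
    moreover have "n * m' = (- u' - w')\<^sup>2 + (- u' - w') * w' + 2 * w'\<^sup>2 + e * w'"
      using m'n by (simp add: power2_eq_square algebra_simps)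
    ultimately have "bianchi_circle (lattice_locus e n m' (- u' - w') w')" by (rule less.hyps)
    from bianchi_circle_moebius[OF this invert]
    have "bianchi_circle (lattice_locus e m' n u' w')"
      by (simp add: moebius_invert_lattice_locus)
    from bianchi_circle_moebius[OF this translate[of "- s" "- t"]]
    have "bianchi_circle (moebius_map (mat2 1 (ok7 (- s) (- t)) 0 1) `
        moebius_map (mat2 1 (ok7 s t) 0 1) ` lattice_locus e m n u w)"
      unfolding step .
    also have "moebius_map (mat2 1 (ok7 (- s) (- t)) 0 1) `
        moebius_map (mat2 1 (ok7 s t) 0 1) ` lattice_locus e m n u w = lattice_locus e m n u w"
      unfolding moebius_translate_lattice_locus
      by (rule arg_cong[of _ _ "\<lambda>x. lattice_locus e x n u w", THEN trans[rotated]])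
        (simp_all add: power2_eq_square algebra_simps)
    finally show ?thesis .
  qed
qed

lemma bianchi_circle_lattice_locus:
  assumes "bianchi_circle S"
  obtains m n u w where "S = lattice_locus 1 m n u w" "m * n = u\<^sup>2 + u * w + 2 * w\<^sup>2 + w"
proof -
  obtain M where M: "M \<in> SL2_O_K7" "S = moebius_map M ` real_line"
    using assms unfolding bianchi_circle_def by blast
  obtain u1 w1 u2 w2 u3 w3 u4 w4 where
    "M$1$1 = ok7 u1 w1" "M$1$2 = ok7 u2 w2" "M$2$1 = ok7 u3 w3" "M$2$2 = ok7 u4 w4"
    using M(1) unfolding SL2_O_K7_def O_K7_iff mem_Collect_eq by metis
  then have M': "M = mat2 (ok7 u1 w1) (ok7 u2 w2) (ok7 u3 w3) (ok7 u4 w4)"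
    by (metis mat2_collapse)
  have det: "ok7 u1 w1 * ok7 u4 w4 - ok7 u2 w2 * ok7 u3 w3 = 1"
    using M(1) unfolding M' mat2_SL2_O_K7 .
  have re: "(u1 * u4 - 2 * w1 * w4) - (u2 * u3 - 2 * w2 * w3) = 1"
    and im: "(u1 * w4 + w1 * u4 + w1 * w4) - (u2 * w3 + w2 * u3 + w2 * w3) = 0"
  proof -
    let ?x = "(u1 * u4 - 2 * w1 * w4) - (u2 * u3 - 2 * w2 * w3)"
    let ?y = "(u1 * w4 + w1 * u4 + w1 * w4) - (u2 * w3 + w2 * u3 + w2 * w3)"
    have "ok7 ?x ?y = 1" using det unfolding ok7_mult by (simp add: complex_eq_iff field_simps)
    then have "real_of_int ?x + ?y / 2 = 1" "sqrt 7 * real_of_int ?y / 2 = 0"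
      by (simp_all only: complex_eq_iff ok7_sel one_complex.sel)
    then have "real_of_int ?y = 0" "real_of_int ?x = 1" by simp_all
    then show "?y = 0" "?x = 1" by linarith+
  qed
  \<comment> \<open>For entries \<alpha>, \<beta>, \<gamma>, \<delta> of \<open>M\<close> the image
    of the real line has normal \<i> (\<alpha> cnj \<delta> - \<beta> cnj \<gamma>). Since \<delta>
    - cnj \<delta> = sqrt(-7) w4 and \<gamma> - cnj \<gamma> = sqrt(-7) w3, determinant 1 turns this
    into \<i> (1 - sqrt(-7) \<zeta>) with \<zeta> = w4 \<alpha> - w3 \<beta>; \<open>u\<close> and
    \<open>w\<close> are the coordinates of \<zeta>.\<close>
  define m n u w where "m = u1 * w2 - w1 * u2" and "n = u3 * w4 - w3 * u4"
    and "u = u1 * w4 - u2 * w3" and "w = w1 * w4 - w2 * w3"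
  have re': "real_of_int u1 * u4 = 1 + 2 * w1 * w4 + (u2 * u3 - 2 * w2 * w3)"
    and im': "real_of_int w1 * u4 = (u2 * w3 + w2 * u3 + w2 * w3) - (u1 * w4 + w1 * w4)"
    using arg_cong[OF re, of real_of_int] arg_cong[OF im, of real_of_int] by simp_all
  have "S = lattice_locus 1 m n u w"
    unfolding M(2) M' real_line_circle_locus lattice_locus_def
  proof (subst moebius_circle_locus[OF det], rule arg_cong3[of _ _ _ _ _ _ circle_locus], goal_cases)
    case 1
    show ?case by (simp add: m_def algebra_simps add_divide_distrib)
  next
    case 2
    show ?case by (simp add: n_def algebra_simps add_divide_distrib)
  next
    case 3
    have im7: "sqrt 7 * (real_of_int w1 * u4) =
        sqrt 7 * ((u2 * w3 + w2 * u3 + w2 * w3) - (u1 * w4 + w1 * w4))"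
      by (simp only: im')
    show ?case
    proof (rule complex_eqI, goal_cases)
      case 1
      show ?case using im7 by (simp add: u_def w_def field_simps)
    next
      case 2
      show ?case using re' im' by (simp add: w_def field_simps sqrt7_sqr)
    qed
  qed
  moreover have "m * n = u\<^sup>2 + u * w + 2 * w\<^sup>2 + w"
    using re im unfolding m_def n_def u_def w_def by algebra
  ultimately show ?thesis by (rule that)
qed

section \<open>Passing between oriented circles and their vectors\<close>

lemma oriented_circle_data:
  assumes "C \<in> oriented_circles"
  obtains b' b a where "is_circle_data C b' b a"
  using circle_data_unique[OF assms] by blast

lemma pi_vec_eqI:
  assumes "C \<in> oriented_circles" "is_circle_data C b' b a"
  shows "pi_vec C = vector [b', b, Re a, Im a]"
  unfolding pi_vec_def
proof (rule the_equality)
  fix v assume "\<exists>b' b a. is_circle_data C b' b a \<and> v = vector [b', b, Re a, Im a]"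
  then show "v = vector [b', b, Re a, Im a]"
    using circle_data_unique[OF assms(1)] assms(2) by blast
qed (use assms(2) in blast)

lemma circle_data_determines:
  assumes "C \<in> oriented_circles" "is_circle_data C b' b a"
  shows "C = (if b > 0 then ccw_circle (a / of_real b) (1 / b)
    else if b < 0 then cw_circle (a / of_real b) (- 1 / b) else oriented_line a (b' / 2))"
  using assms by (auto simp: oriented_circles_def is_circle_data_ccw is_circle_data_cw
      is_circle_data_line)

lemma vector4_eq_iff:
  "(vector [a, b, c, d] :: 'a::zero^4) = vector [a', b', c', d'] \<longleftrightarrow> a = a' \<and> b = b' \<and> c = c' \<and> d = d'"
  by (simp add: vec_eq_iff forall_4 vector_4)

lemma inj_on_pi_vec: "inj_on pi_vec oriented_circles"
proof (rule inj_onI)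
  fix C D assume CD: "C \<in> oriented_circles" "D \<in> oriented_circles" "pi_vec C = pi_vec D"
  obtain b' b a where C: "is_circle_data C b' b a" using oriented_circle_data[OF CD(1)] .
  obtain c' c d where D: "is_circle_data D c' c d" using oriented_circle_data[OF CD(2)] .
  have "b' = c'" "b = c" "a = d"
    using CD(3) unfolding pi_vec_eqI[OF CD(1) C] pi_vec_eqI[OF CD(2) D] vector4_eq_iff
    by (simp_all add: complex_eq_iff)
  then show "C = D"
    using circle_data_determines[OF CD(1) C] circle_data_determines[OF CD(2) D] by simp
qed

lemma pedoe_pi_vec_self:
  assumes "C \<in> oriented_circles"
  shows "pedoe (pi_vec C) (pi_vec C) = 1"
proof -
  obtain b' b a where C: "is_circle_data C b' b a" using oriented_circle_data[OF assms] .
  then have "b * b' = (Re a)\<^sup>2 + (Im a)\<^sup>2 - 1" by (simp add: is_circle_data_def cmod_power2)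
  then show ?thesis
    unfolding pi_vec_eqI[OF assms C]
    by (simp add: pedoe_def vector_4 power2_eq_square mult.commute field_simps)
qed

lemma oriented_circle_exists:
  assumes "b * b' = (cmod a)\<^sup>2 - 1"
  obtains C where "C \<in> oriented_circles" "is_circle_data C b' b a"
proof -
  have b': "b' = ((cmod (a / of_real b))\<^sup>2 - (1 / b)\<^sup>2) / (1 / b)" if "b \<noteq> 0"
  proof -
    have "(cmod (a / of_real b))\<^sup>2 - (1 / b)\<^sup>2 = b * b' / b\<^sup>2"
      using assms by (simp add: norm_divide power_divide diff_divide_distrib)
    then show ?thesis using that by (simp add: power2_eq_square)
  qed
  consider "b > 0" | "b < 0" | "b = 0" by linarith
  then show ?thesis
  proof cases
    case 1
    then have "is_circle_data (ccw_circle (a / of_real b) (1 / b)) b' b a"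
      using 1 b' by (subst is_circle_data_ccw) simp_all
    moreover have "1 / b > 0" using 1 by simp
    then have "ccw_circle (a / of_real b) (1 / b) \<in> oriented_circles"
      unfolding oriented_circles_def by blast
    ultimately show ?thesis using that by blast
  next
    case 2
    then have "is_circle_data (cw_circle (a / of_real b) (- 1 / b)) b' b a"
      using 2 b' by (subst is_circle_data_cw) (simp_all add: algebra_simps)
    moreover have "- 1 / b > 0" using 2 by (simp add: divide_neg_neg)
    then have "cw_circle (a / of_real b) (- 1 / b) \<in> oriented_circles"
      unfolding oriented_circles_def by blast
    ultimately show ?thesis using that by blast
  next
    case 3
    then have "(cmod a)\<^sup>2 = 1" using assms by simp
    then have "cmod a = 1" using power2_eq_1_iff[of "cmod a"] norm_ge_zero[of a] by linarith
    then have "is_circle_data (oriented_line a (b' / 2)) b' b a" 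
      using 3 by (simp add: is_circle_data_line)
    then show ?thesis using \<open>cmod a = 1\<close> that unfolding oriented_circles_def by blast
  qed
qed

text \<open>The point t n is moved along the line by the part of \<open>a\<close> orthogonal to
  \<open>n\<close>. The product with \<open>a\<close> must not change, so that part vanishes and n
  \<bullet> a is 1 or -1.\<close>

lemma line_normal_unique:
  fixes a n :: complex
  assumes "\<And>z. a \<bullet> z = s \<longleftrightarrow> n \<bullet> z = t" "norm a = 1" "norm n = 1"
  shows "a = n \<or> a = - n"
proof -
  have nn: "n \<bullet> n = 1" "a \<bullet> a = 1" using assms(2,3) by (simp_all add: dot_square_norm)
  have 1: "a \<bullet> (t *\<^sub>R n) = s" using assms(1)[of "t *\<^sub>R n"] nn by simp
  have "a \<bullet> (t *\<^sub>R n + (a - (n \<bullet> a) *\<^sub>R n)) = s"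
    unfolding assms(1) using nn by (simp add: inner_diff_right inner_add_right)
  with 1 have "(n \<bullet> a)\<^sup>2 = 1"
    using nn by (simp add: inner_diff_right inner_add_right inner_commute power2_eq_square)
  then have "n \<bullet> a = 1 \<or> n \<bullet> a = -1" by (simp add: power2_eq_1_iff)
  then have "(a - n) \<bullet> (a - n) = 0 \<or> (a + n) \<bullet> (a + n) = 0"
    using nn by (auto simp: inner_diff inner_add inner_commute)
  then show ?thesis by (auto simp: add_eq_0_iff2)
qed

text \<open>Only the orientation clause can fail, and negating all data repairs it: on circles the
  sign of \<open>b\<close> decides, on lines the direction of the normal.\<close>

lemma circle_data_of_locus:
  assumes "C \<in> oriented_circles" "b * b' = (cmod a)\<^sup>2 - 1" "fst C = circle_locus b' b a"
  shows "is_circle_data C b' b a \<or> is_circle_data C (- b') (- b) (- a)"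
proof -
  have neg: "- b * - b' = (cmod (- a))\<^sup>2 - 1" "fst C = circle_locus (- b') (- b) (- a)"
    using assms by (simp_all add: circle_locus_minus)
  consider c r where "r > 0" "C = ccw_circle c r" | c r where "r > 0" "C = cw_circle c r"
    | n t where "norm n = 1" "C = oriented_line n t"
    using assms(1) unfolding oriented_circles_def by blast
  then show ?thesis
  proof cases
    case 1
    have "None \<notin> fst C" by (auto simp: 1 ccw_circle_def)
    then have "b \<noteq> 0" unfolding assms(3) None_in_circle_locus .
    then consider "b > 0" | "- b > 0" by linarith
    then show ?thesis
      using assms neg 1 ccw_neq_cw circle_neq_line unfolding is_circle_data_def by cases metis+
  next
    case 2
    have "None \<notin> fst C" by (auto simp: 2 cw_circle_def)
    then have "b \<noteq> 0" unfolding assms(3) None_in_circle_locus .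
    then consider "b < 0" | "- b < 0" by linarith
    then show ?thesis
      using assms neg 2 ccw_neq_cw circle_neq_line unfolding is_circle_data_def by cases metis+
  next
    case 3
    have "None \<in> fst C" by (simp add: 3 oriented_line_def)
    then have b: "b = 0" unfolding assms(3) None_in_circle_locus .
    then have "(cmod a)\<^sup>2 = 1" using assms(2) by simp
    then have "norm a = 1" using power2_eq_1_iff[of "cmod a"] norm_ge_zero[of a] by linarith
    moreover have "a \<bullet> z = b' / 2 \<longleftrightarrow> n \<bullet> z = t" for z
    proof -
      have "Some z \<in> fst C \<longleftrightarrow> n \<bullet> z = t" by (auto simp: 3 oriented_line_def)
      moreover have "Some z \<in> fst C \<longleftrightarrow> a \<bullet> z = b' / 2"
        unfolding assms(3) b by (auto simp: circle_locus_line)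
      ultimately show ?thesis by blast
    qed
    ultimately have "a = n \<or> a = - n" using 3(1) by (intro line_normal_unique)
    then have "a = n \<or> - a = n" by auto
    then show ?thesis
      using assms(2,3) neg 3 circle_neq_line oriented_line_inj(1)
      unfolding is_circle_data_def by metis
  qed
qed

lemma lattice_locus_norm:
  fixes e m n u w :: int
  assumes "e \<in> {1, -1}"
  shows "m * n = u\<^sup>2 + u * w + 2 * w\<^sup>2 + e * w \<longleftrightarrow>
    (sqrt 7 * n) * (sqrt 7 * m) = (cmod (lattice_normal e u w))\<^sup>2 - 1"
proof -
  have "(cmod (lattice_normal e u w))\<^sup>2 - 1 =
      7 * (u + w / 2)\<^sup>2 + (e + 7 * w / 2)\<^sup>2 - 1"
    by (simp add: cmod_power2 power_mult_distrib)
  also have "\<dots> = 7 * real_of_int (u\<^sup>2 + u * w + 2 * w\<^sup>2 + e * w)"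
    by (rule lattice_norm_form[OF assms, symmetric])
  finally have "(sqrt 7 * n) * (sqrt 7 * m) = (cmod (lattice_normal e u w))\<^sup>2 - 1
    \<longleftrightarrow> 7 * real_of_int (m * n) = 7 * real_of_int (u\<^sup>2 + u * w + 2 * w\<^sup>2 + e * w)"
    by (simp add: sqrt7_sqr mult.assoc mult.left_commute mult.commute)
  also have "\<dots> \<longleftrightarrow> m * n = u\<^sup>2 + u * w + 2 * w\<^sup>2 + e * w"
    by (simp only: mult_cancel_left of_int_eq_iff) simp
  finally show ?thesis by simp
qed

lemma sqrt7_lattice_minus:
  assumes "v \<in> sqrt7_lattice e"
  shows "- v \<in> sqrt7_lattice (- e)"
proof -
  obtain m n u w :: int where "v = lattice_vec e m n u w"
    using assms unfolding sqrt7_lattice_def by blast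
  then have "- v = lattice_vec (- e) (- m) (- n) (- u) (- w)"
    by (simp add: lattice_vec_def vec_eq_iff forall_4 vector_4 algebra_simps)
  then show ?thesis unfolding sqrt7_lattice_def by blast
qed

lemma bianchi_pi_vec:
  assumes "C \<in> oriented_bianchi_circles"
  shows "\<exists>e\<in>{1, -1}. pi_vec C \<in> sqrt7_lattice e"
proof -
  have C: "C \<in> oriented_circles" "bianchi_circle (fst C)"
    using assms by (simp_all add: oriented_bianchi_circles_def)
  obtain m n u w where *: "fst C = lattice_locus 1 m n u w" "m * n = u\<^sup>2 + u * w + 2 * w\<^sup>2 + w"
    using bianchi_circle_lattice_locus[OF C(2)] .
  define a where "a = lattice_normal 1 u w"
  define v where "v = lattice_vec 1 m n u w"
  have "is_circle_data C (sqrt 7 * m) (sqrt 7 * n) a \<or>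
      is_circle_data C (- (sqrt 7 * m)) (- (sqrt 7 * n)) (- a)"
    using circle_data_of_locus[OF C(1), of "sqrt 7 * n" "sqrt 7 * m" a] * lattice_locus_norm[of 1 m n u w]
    by (simp add: lattice_locus_def a_def)
  then have "pi_vec C = v \<or> pi_vec C = - v"
    using pi_vec_eqI[OF C(1)] by (fastforce simp: v_def lattice_vec_def a_def vec_eq_iff forall_4 vector_4)
  moreover have "v \<in> sqrt7_lattice 1" unfolding sqrt7_lattice_def v_def by fastforce
  ultimately show ?thesis using sqrt7_lattice_minus[of v 1] by auto
qed

lemma bianchi_circle_exists:
  assumes "v \<in> sqrt7_lattice e" "e \<in> {1, -1}" "pedoe v v = 1"
  shows "\<exists>C\<in>oriented_bianchi_circles. pi_vec C = v"
proof -
  obtain m n u w :: int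
    where v: "v = lattice_vec e m n u w"
    using assms(1) unfolding sqrt7_lattice_def by blast
  define a where "a = lattice_normal e u w"
  have eq: "(sqrt 7 * n) * (sqrt 7 * m) = (cmod a)\<^sup>2 - 1"
    using assms(3) unfolding a_def cmod_power2
    by (simp add: v lattice_vec_def pedoe_def vector_4 power2_eq_square algebra_simps sqrt7_sqr)
  obtain C where C: "C \<in> oriented_circles" "is_circle_data C (sqrt 7 * m) (sqrt 7 * n) a"
    using oriented_circle_exists[OF eq] .
  have "fst C = lattice_locus e m n u w"
    using C(2) by (simp add: is_circle_data_def lattice_locus_def a_def)
  then have "bianchi_circle (fst C)"
    using bianchi_lattice_locus[OF assms(2)] eq lattice_locus_norm[OF assms(2)] unfolding a_def by simp
  moreover have "pi_vec C = v" using pi_vec_eqI[OF C] by (simp add: v lattice_vec_def a_def)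
  ultimately show ?thesis using C(1) unfolding oriented_bianchi_circles_def by blast
qed

text \<open>Twice the product is 2 e d modulo 7, all remaining terms being multiples of 7. As -5 is
  congruent to 2, the value -5/2 gives e d = 1, while -1 gives e d = -1.\<close>

lemma lattice_sign:
  assumes "v \<in> sqrt7_lattice e" "x \<in> sqrt7_lattice d" "e \<in> {1, -1}" "d \<in> {1, -1}"
  shows "pedoe v x = -5/2 \<Longrightarrow> d = e" "pedoe v x = -1 \<Longrightarrow> d = - e"
proof -
  obtain m n u w :: int
    where v: "v = lattice_vec e m n u w"
    using assms(1) unfolding sqrt7_lattice_def by blast
  obtain m' n' u' w' :: int
    where x: "x = lattice_vec d m' n' u' w'"
    using assms(2) unfolding sqrt7_lattice_def by blast
  define k where "k = - m * n' - n * m' + 2 * u * u' + u * w' + w * u' + 4 * w * w' + e * w' + d * w"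
  have eq: "2 * pedoe v x = real_of_int (2 * e * d + 7 * k)"
    by (simp add: v x lattice_vec_def pedoe_def vector_4 k_def algebra_simps sqrt7_sqr add_divide_distrib)
  show "d = e" if "pedoe v x = -5/2"
  proof -
    have "real_of_int (2 * e * d + 7 * k) = of_int (- 5)" using eq that by simp
    then have "2 * e * d + 7 * k = - 5" by (simp only: of_int_eq_iff)
    then show ?thesis using assms(3,4) by (auto; presburger)
  qed
  show "d = - e" if "pedoe v x = -1"
  proof -
    have "real_of_int (2 * e * d + 7 * k) = of_int (- 2)" using eq that by simp
    then have "2 * e * d + 7 * k = - 2" by (simp only: of_int_eq_iff)
    then show ?thesis using assms(3,4) by (auto; presburger)
  qed
qed

text \<open>The constants add up to 2 e + 2 e + e + e = -e + 7 e. The surplus 7 e is absorbed by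
  raising \<open>w\<close> by 2 e, and lowering \<open>u\<close> by \<open>e\<close> restores the
  real part.\<close>

lemma lattice_exchange:
  assumes "p \<in> sqrt7_lattice e" "p' \<in> sqrt7_lattice e"
    "q \<in> sqrt7_lattice (- e)" "q' \<in> sqrt7_lattice (- e)"
  shows "2 *\<^sub>R (p + p') - (q + q') \<in> sqrt7_lattice (- e)"
proof -
  obtain m1 n1 u1 w1 :: int
    where p: "p = lattice_vec e m1 n1 u1 w1"
    using assms(1) unfolding sqrt7_lattice_def by blast
  obtain m2 n2 u2 w2 :: int
    where p': "p' = lattice_vec e m2 n2 u2 w2"
    using assms(2) unfolding sqrt7_lattice_def by blast
  obtain m3 n3 u3 w3 :: int
    where q: "q = lattice_vec (- e) m3 n3 u3 w3"
    using assms(3) unfolding sqrt7_lattice_def by blast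
  obtain m4 n4 u4 w4 :: int
    where q': "q' = lattice_vec (- e) m4 n4 u4 w4"
    using assms(4) unfolding sqrt7_lattice_def by blast
  define m n u w where "m = 2 * (m1 + m2) - m3 - m4" and "n = 2 * (n1 + n2) - n3 - n4"
    and "u = 2 * (u1 + u2) - u3 - u4 - e" and "w = 2 * (w1 + w2) - w3 - w4 + 2 * e"
  have "2 *\<^sub>R (p + p') - (q + q') = lattice_vec (- e) m n u w"
    by (simp add: lattice_vec_def p p' q q' m_def n_def u_def w_def vec_eq_iff forall_4 vector_4 algebra_simps
        add_divide_distrib diff_divide_distrib)
  then show ?thesis unfolding sqrt7_lattice_def by blast
qed


section \<open>The tent graph\<close>

abbreviation prod_circ :: "ocircle \<Rightarrow> ocircle \<Rightarrow> real" where
  "prod_circ C D \<equiv> pedoe (pi_vec C) (pi_vec D)"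

lemma pedoe_commute: "pedoe v w = pedoe w v"
  by (simp add: pedoe_def)

lemma pedoe_left:
  "pedoe (v + w) x = pedoe v x + pedoe w x"
  "pedoe (v - w) x = pedoe v x - pedoe w x"
  "pedoe (r *\<^sub>R v) x = r * pedoe v x"
  "pedoe (- v) x = - pedoe v x"
  "pedoe 0 x = 0"
  by (simp_all add: pedoe_def algebra_simps)

lemma pedoe_right:
  "pedoe x (v + w) = pedoe x v + pedoe x w"
  "pedoe x (v - w) = pedoe x v - pedoe x w"
  "pedoe x (r *\<^sub>R v) = r * pedoe x v"
  "pedoe x (- v) = - pedoe x v"
  "pedoe x 0 = 0"
  by (simp_all add: pedoe_def algebra_simps)

lemma oriented_bianchi_circlesD: "C \<in> oriented_bianchi_circles \<Longrightarrow> C \<in> oriented_circles"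
  by (simp add: oriented_bianchi_circles_def)

text \<open>The set \<open>P\<close> consists of the peaks of the tent \<open>P \<union> Q\<close>.\<close>

definition tent_split :: "ocircle set \<Rightarrow> ocircle set \<Rightarrow> bool" where
  "tent_split P Q \<longleftrightarrow> P \<union> Q \<subseteq> oriented_bianchi_circles \<and> card P = 3 \<and> card Q = 2 \<and>
     (\<forall>p\<in>P. \<forall>p'\<in>P. p \<noteq> p' \<longrightarrow> prod_circ p p' = -5/2) \<and>
     (\<forall>q\<in>Q. \<forall>q'\<in>Q. q \<noteq> q' \<longrightarrow> prod_circ q q' = -5/2) \<and>
     (\<forall>p\<in>P. \<forall>q\<in>Q. prod_circ p q = -1)"

lemma tent_split_prods:
  assumes "tent_split P Q"
  shows "P \<union> Q \<subseteq> oriented_bianchi_circles"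
    and "\<And>p p'. p \<in> P \<Longrightarrow> p' \<in> P \<Longrightarrow> p \<noteq> p' \<Longrightarrow> prod_circ p p' = -5/2"
    and "\<And>q q'. q \<in> Q \<Longrightarrow> q' \<in> Q \<Longrightarrow> q \<noteq> q' \<Longrightarrow> prod_circ q q' = -5/2"
    and "\<And>p q. p \<in> P \<Longrightarrow> q \<in> Q \<Longrightarrow> prod_circ p q = -1"
  using assms unfolding tent_split_def by (elim conjE; simp only: Ball_def; metis)+

text \<open>The listed products imply the cardinalities, since every circle has product 1 with
  itself and coinciding circles in a class would violate -5/2.\<close>

lemma tent_split_explicit:
  "tent_split P Q \<longleftrightarrow> (\<exists>a b c d e. P = {a, b, c} \<and> Q = {d, e} \<and>
     {a, b, c, d, e} \<subseteq> oriented_bianchi_circles \<and>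
     prod_circ a b = -5/2 \<and> prod_circ a c = -5/2 \<and> prod_circ b c = -5/2 \<and> prod_circ d e = -5/2 \<and>
     prod_circ a d = -1 \<and> prod_circ a e = -1 \<and> prod_circ b d = -1 \<and> prod_circ b e = -1 \<and>
     prod_circ c d = -1 \<and> prod_circ c e = -1)" (is "_ \<longleftrightarrow> ?R")
proof
  assume L: "tent_split P Q"
  then have card: "card P = 3" "card Q = 2" unfolding tent_split_def by blast+
  obtain a b c where abc: "P = {a, b, c}" "a \<noteq> b" "b \<noteq> c" "a \<noteq> c"
    using card(1) unfolding card_3_iff by blast
  obtain d e where de: "Q = {d, e}" "d \<noteq> e"
    using card(2) unfolding card_2_iff by blast
  show ?R
    by (rule exI[of _ a], rule exI[of _ b], rule exI[of _ c], rule exI[of _ d], rule exI[of _ e])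
      (use abc de tent_split_prods[OF L] in simp)
next
  assume ?R
  then obtain a b c d e where *: "P = {a, b, c}" "Q = {d, e}"
     "{a, b, c, d, e} \<subseteq> oriented_bianchi_circles"
     "prod_circ a b = -5/2" "prod_circ a c = -5/2" "prod_circ b c = -5/2" "prod_circ d e = -5/2"
     "prod_circ a d = -1" "prod_circ a e = -1" "prod_circ b d = -1" "prod_circ b e = -1"
     "prod_circ c d = -1" "prod_circ c e = -1" by blast
  have self: "prod_circ x x = 1" if "x \<in> {a, b, c, d, e}" for x
    using that *(3) pedoe_pi_vec_self oriented_bianchi_circlesD by blast
  have "a \<noteq> b" "a \<noteq> c" "b \<noteq> c" "d \<noteq> e"
    using self[of a] self[of b] self[of d] * by auto
  then show "tent_split P Q"
    using *(3-) pedoe_commute[of "pi_vec b" "pi_vec a"] pedoe_commute[of "pi_vec c" "pi_vec a"]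
      pedoe_commute[of "pi_vec c" "pi_vec b"] pedoe_commute[of "pi_vec e" "pi_vec d"]
    unfolding tent_split_def *(1,2) by simp
qed

lemma tent_splitD:
  assumes "tent_split P Q"
  shows "finite P" "finite Q" "card P = 3" "card Q = 2" "P \<inter> Q = {}" "P \<noteq> {}" "Q \<noteq> {}"
    "P \<union> Q \<subseteq> oriented_bianchi_circles"
    "\<And>x y. x \<in> P \<Longrightarrow> y \<in> P \<Longrightarrow> prod_circ x y \<noteq> -1"
    "\<And>x y. x \<in> Q \<Longrightarrow> y \<in> Q \<Longrightarrow> prod_circ x y \<noteq> -1"
    "\<And>x y. x \<in> P \<Longrightarrow> y \<in> Q \<Longrightarrow> prod_circ x y = -1"
proof -
  note prods = tent_split_prods[OF assms]
  have self: "prod_circ x x = 1" if "x \<in> P \<union> Q" for x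
    using that prods(1) pedoe_pi_vec_self oriented_bianchi_circlesD by blast
  show "P \<union> Q \<subseteq> oriented_bianchi_circles" by (rule prods(1))
  show card: "card P = 3" "card Q = 2" using assms unfolding tent_split_def by simp_all
  from card show "finite P" "finite Q" "P \<noteq> {}" "Q \<noteq> {}"
    by (auto intro: card_ge_0_finite)
  show "prod_circ x y \<noteq> -1" if "x \<in> P" "y \<in> P" for x y
    using that prods(2)[of x y] self[of x] by (cases "x = y") simp_all
  show "prod_circ x y \<noteq> -1" if "x \<in> Q" "y \<in> Q" for x y
    using that prods(3)[of x y] self[of x] by (cases "x = y") simp_all
  show PQ: "prod_circ x y = -1" if "x \<in> P" "y \<in> Q" for x y
    using that by (rule prods(4))
  show "P \<inter> Q = {}"
  proof (rule ccontr)
    assume "P \<inter> Q \<noteq> {}"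
    then obtain x where "x \<in> P" "x \<in> Q" by blast
    then show False using PQ[of x x] self[of x] by simp
  qed
qed

lemma all_less_5: "(\<forall>i<5. R i) \<longleftrightarrow> R 0 \<and> R 1 \<and> R 2 \<and> R 3 \<and> R (4::nat)"
  by (auto simp: eval_nat_numeral less_Suc_eq)

lemma tent_imp_split:
  assumes "tent Cs"
  shows "tent_split {Cs ! 0, Cs ! 2, Cs ! 4} {Cs ! 1, Cs ! 3}"
    "set Cs = {Cs ! 0, Cs ! 2, Cs ! 4} \<union> {Cs ! 1, Cs ! 3}"
proof -
  have "length Cs = 5" using assms by (simp add: tent_def)
  then obtain a d b e c where Cs: "Cs = [a, d, b, e, c]"
    by (auto simp: eval_nat_numeral length_Suc_conv)
  show "tent_split {Cs ! 0, Cs ! 2, Cs ! 4} {Cs ! 1, Cs ! 3}"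
    unfolding tent_split_explicit
    by (rule exI[of _ a], rule exI[of _ b], rule exI[of _ c], rule exI[of _ d], rule exI[of _ e])
      (use assms in \<open>simp add: tent_def all_less_5 tent_products_def Cs pedoe_commute\<close>)
  show "set Cs = {Cs ! 0, Cs ! 2, Cs ! 4} \<union> {Cs ! 1, Cs ! 3}"
    by (auto simp: Cs)
qed

lemma split_imp_tent:
  assumes "tent_split P Q"
  obtains Cs where "tent Cs" "set Cs = P \<union> Q" "P = {Cs ! 0, Cs ! 2, Cs ! 4}"
proof -
  obtain a b c d e where *: "P = {a, b, c}" "Q = {d, e}"
     "{a, b, c, d, e} \<subseteq> oriented_bianchi_circles"
     "prod_circ a b = -5/2" "prod_circ a c = -5/2" "prod_circ b c = -5/2" "prod_circ d e = -5/2"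
     "prod_circ a d = -1" "prod_circ a e = -1" "prod_circ b d = -1" "prod_circ b e = -1"
     "prod_circ c d = -1" "prod_circ c e = -1"
    using assms unfolding tent_split_explicit by blast
  have self: "prod_circ x x = 1" if "x \<in> {a, b, c, d, e}" for x
    using that *(3) pedoe_pi_vec_self oriented_bianchi_circlesD by blast
  have "tent [a, d, b, e, c]"
    using * self[of a] self[of b] self[of c] self[of d] self[of e]
    by (simp add: tent_def all_less_5 tent_products_def pedoe_commute)
  then show ?thesis using that[of "[a, d, b, e, c]"] *(1,2) by auto
qed

lemma tent_vertices_iff: "T \<in> tent_vertices \<longleftrightarrow> (\<exists>P Q. tent_split P Q \<and> T = P \<union> Q)"
proof
  assume "T \<in> tent_vertices"
  then show "\<exists>P Q. tent_split P Q \<and> T = P \<union> Q"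
    using tent_imp_split unfolding tent_vertices_def by blast
next
  assume "\<exists>P Q. tent_split P Q \<and> T = P \<union> Q"
  then show "T \<in> tent_vertices"
    unfolding tent_vertices_def by (metis (mono_tags, lifting) mem_Collect_eq split_imp_tent)
qed

text \<open>
  On a tent, having Pedoe product different from \<open>-1\<close> is an equivalence relation whose classes are the
  peaks and the base.
\<close>

lemma tent_split_unique:
  assumes "tent_split P Q" "tent_split P' Q'" "P \<union> Q = P' \<union> Q'"
  shows "P' = P" "Q' = Q"
proof -
  note D = tent_splitD[OF assms(1)] and D' = tent_splitD[OF assms(2)]
  obtain x where x: "x \<in> P'" using D' by blast
  have P': "P' = {y \<in> P \<union> Q. prod_circ x y \<noteq> -1}"
    using x D'(9)[OF x] D'(11)[OF x] unfolding assms(3) by auto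
  show "P' = P"
  proof (cases "x \<in> P")
    case True
    then show ?thesis using D(9)[OF True] D(11)[OF True] unfolding P' by blast
  next
    case False
    then have "x \<in> Q" using x assms(3) by blast
    then have "P' = Q" using D(10)[of x] D(11)[of _ x] unfolding P' by (auto simp: pedoe_commute)
    then show ?thesis using D(4) D'(3) by simp
  qed
  then show "Q' = Q" using assms(3) D(5) D'(5) by blast
qed

lemma belts_tent_split:
  assumes "tent_split P Q"
  shows "belts (P \<union> Q) = (\<lambda>c. (P - {c}) \<union> Q) ` P"
proof -
  have *: "P \<union> Q - {c} = (P - {c}) \<union> Q" if "c \<in> P" for c
    using that tent_splitD(5)[OF assms] by blast
  have "belts (P \<union> Q) = (\<lambda>c. P \<union> Q - {c}) ` P"
  proof (rule Set.set_eqI, rule iffI)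
    fix B assume "B \<in> belts (P \<union> Q)"
    then obtain c Cs where c: "B = P \<union> Q - {c}" "tent Cs" "set Cs = P \<union> Q"
      "c \<in> {Cs ! 0, Cs ! 2, Cs ! 4}"
      unfolding belts_def by blast
    have "{Cs ! 0, Cs ! 2, Cs ! 4} = P"
      using tent_split_unique(1)[OF assms tent_imp_split(1)[OF c(2)]] tent_imp_split(2)[OF c(2)] c(3)
      by metis
    with c show "B \<in> (\<lambda>c. P \<union> Q - {c}) ` P" by blast
  next
    fix B assume "B \<in> (\<lambda>c. P \<union> Q - {c}) ` P"
    then obtain c where "c \<in> P" "B = P \<union> Q - {c}" by blast
    moreover obtain Cs where "tent Cs" "set Cs = P \<union> Q" "P = {Cs ! 0, Cs ! 2, Cs ! 4}"
      using split_imp_tent[OF assms] by blast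
    ultimately show "B \<in> belts (P \<union> Q)" unfolding belts_def by blast
  qed
  also have "\<dots> = (\<lambda>c. (P - {c}) \<union> Q) ` P"
    using * by (rule image_cong[OF refl])
  finally show ?thesis .
qed

section \<open>The linear relation of a tent and the exchange of a peak\<close>

text \<open>The Gram matrix of a belt is invertible, so its four vectors form a basis.
  \<open>G\<close> is the matrix of the Pedoe form and \<open>H\<close> the inverse of the Gram
  matrix.\<close>

lemma pedoe_nondegenerate:
  fixes a b d e v :: "real^4"
  assumes self: "pedoe a a = 1" "pedoe b b = 1" "pedoe d d = 1" "pedoe e e = 1"
    and ab: "pedoe a b = -5/2" and de: "pedoe d e = -5/2"
    and cross: "pedoe a d = -1" "pedoe a e = -1" "pedoe b d = -1" "pedoe b e = -1"
    and v: "pedoe a v = 0" "pedoe b v = 0" "pedoe d v = 0" "pedoe e v = 0"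
  shows "v = 0"
proof -
  define A :: "real^4^4" where "A = vector [a, b, d, e]"
  define G :: "real^4^4" where "G = vector [vector [0, -1/2, 0, 0], vector [-1/2, 0, 0, 0],
    vector [0, 0, 1, 0], vector [0, 0, 0, 1]]"
  define H :: "real^4^4" where "H = vector [vector [4/7, 2/7, -4/7, -4/7],
    vector [2/7, 4/7, -4/7, -4/7], vector [-4/7, -4/7, 4/7, 2/7], vector [-4/7, -4/7, 2/7, 4/7]]"
  have AG: "((A ** G) *v w) $ i = pedoe (A $ i) w" for w i
    by (simp add: matrix_vector_mult_def matrix_matrix_mult_def sum_4 G_def vector_4 pedoe_def
        algebra_simps)
  have gram: "(A ** G ** transpose A) $ i $ j = pedoe (A $ i) (A $ j)" for i j
    using AG[of "A $ j" i]
    by (simp add: matrix_vector_mult_def matrix_matrix_mult_def transpose_def)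
  have A: "A $ 1 = a" "A $ 2 = b" "A $ 3 = d" "A $ 4 = e"
    by (simp_all add: A_def vector_4)
  note rows = A self ab de cross pedoe_commute[of b a] pedoe_commute[of e d]
    pedoe_commute[of d a] pedoe_commute[of d b] pedoe_commute[of e a] pedoe_commute[of e b]
  have "A ** G ** transpose A ** H = mat 1"
    unfolding vec_eq_iff matrix_matrix_mult_def[of "A ** G ** transpose A"]
    by (simp add: forall_4 sum_4 gram rows H_def vector_4 mat_def)
  \<comment> \<open>A right inverse of the square matrix \<open>A ** G\<close> is also a left
    inverse, which recovers \<open>v\<close> from its four products.\<close>
  then have "transpose A ** H ** (A ** G) = mat 1"
    by (metis matrix_left_right_inverse matrix_mul_assoc)
  then have "v = (transpose A ** H) *v ((A ** G) *v v)"
    by (simp add: matrix_vector_mul_assoc)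
  moreover have "(A ** G) *v v = 0"
    unfolding vec_eq_iff AG by (simp add: forall_4 rows v)
  ultimately show "v = 0" by simp
qed

text \<open>The difference of the two sides is orthogonal to a belt: against a peak it gives 1 - 5/2
  - 5/2 + 4 = 0, against a base circle -3 - 2 (1 - 5/2) = 0.\<close>

lemma tent_relation:
  assumes "tent_split P Q"
  shows "(\<Sum>p\<in>P. pi_vec p) = 2 *\<^sub>R (\<Sum>q\<in>Q. pi_vec q)"
proof -
  obtain a b c d e where *: "P = {a, b, c}" "Q = {d, e}"
     "{a, b, c, d, e} \<subseteq> oriented_bianchi_circles"
     "prod_circ a b = -5/2" "prod_circ a c = -5/2" "prod_circ b c = -5/2" "prod_circ d e = -5/2"
     "prod_circ a d = -1" "prod_circ a e = -1" "prod_circ b d = -1" "prod_circ b e = -1"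
     "prod_circ c d = -1" "prod_circ c e = -1"
    using assms unfolding tent_split_explicit by blast
  have self: "prod_circ x x = 1" if "x \<in> {a, b, c, d, e}" for x
    using that *(3) pedoe_pi_vec_self oriented_bianchi_circlesD by blast
  have ne: "a \<noteq> b" "a \<noteq> c" "b \<noteq> c" "d \<noteq> e"
    using self[of a] self[of b] self[of d] * by auto
  define v where "v = pi_vec a + pi_vec b + pi_vec c - 2 *\<^sub>R (pi_vec d + pi_vec e)"
  have "v = 0"
  proof (rule pedoe_nondegenerate)
    show "prod_circ a a = 1" "prod_circ b b = 1" "prod_circ d d = 1" "prod_circ e e = 1"
      using self by blast+
    show "pedoe (pi_vec a) v = 0" "pedoe (pi_vec b) v = 0" "pedoe (pi_vec d) v = 0"
      "pedoe (pi_vec e) v = 0"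
      using * self[of a] self[of b] self[of d] self[of e]
      by (simp_all add: v_def pedoe_right pedoe_commute)
  qed fact+
  then show ?thesis using ne *(1,2) by (simp add: v_def add.assoc)
qed

text \<open>The inverse image under \<open>pi_vec\<close> is meaningful once the vector is known to
  belong to a circle, which \<open>tent_exchange\<close> shows for every peak of a tent.\<close>

definition new_peak :: "ocircle set \<Rightarrow> ocircle set \<Rightarrow> ocircle \<Rightarrow> ocircle" where
  "new_peak P Q c = inv_into oriented_circles pi_vec
     (2 *\<^sub>R (\<Sum>p\<in>P - {c}. pi_vec p) - (\<Sum>q\<in>Q. pi_vec q))"

lemma tent_exchange:
  assumes "tent_split P Q" "c \<in> P"
  shows "tent_split (insert (new_peak P Q c) Q) (P - {c})" (is ?split)
    and "new_peak P Q c \<notin> Q" (is ?notin)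
    and "pi_vec (new_peak P Q c) = 2 *\<^sub>R (\<Sum>p\<in>P - {c}. pi_vec p) - (\<Sum>q\<in>Q. pi_vec q)" (is ?pi)
proof -
  have card: "card (P - {c}) = 2" "card Q = 2" using tent_splitD[OF assms(1)] assms(2) by simp_all
  obtain a b where P: "P - {c} = {a, b}" and ab: "a \<noteq> b"
    using card(1) unfolding card_2_iff by blast
  obtain d e where Q: "Q = {d, e}" and de: "d \<noteq> e"
    using card(2) unfolding card_2_iff by blast
  note ne = ab de
  have abc: "P = {a, b, c}" "a \<noteq> c" "b \<noteq> c" using assms(2) P by blast+
  have B: "{a, b, c, d, e} \<subseteq> oriented_bianchi_circles"
    using tent_splitD(8)[OF assms(1)] abc Q by blast
  have prods: "prod_circ a b = -5/2" "prod_circ d e = -5/2"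
    "prod_circ a d = -1" "prod_circ a e = -1" "prod_circ b d = -1" "prod_circ b e = -1"
    using assms(1) ne unfolding tent_split_def by (simp_all add: abc Q)
  have self: "prod_circ x x = 1" if "x \<in> {a, b, c, d, e}" for x
    using that B pedoe_pi_vec_self oriented_bianchi_circlesD by blast
  define v where "v = 2 *\<^sub>R (pi_vec a + pi_vec b) - (pi_vec d + pi_vec e)"
  have v: "v = 2 *\<^sub>R (\<Sum>p\<in>P - {c}. pi_vec p) - (\<Sum>q\<in>Q. pi_vec q)"
    using ne by (simp add: P Q v_def)
  obtain s where s: "s \<in> {1, -1}" "pi_vec a \<in> sqrt7_lattice s"
    using B bianchi_pi_vec[of a] by auto
  have "pi_vec b \<in> sqrt7_lattice s" "pi_vec d \<in> sqrt7_lattice (- s)" "pi_vec e \<in> sqrt7_lattice (- s)"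
  proof -
    obtain b' where t: "b' \<in> {1, -1}" "pi_vec b \<in> sqrt7_lattice b'"
      using B bianchi_pi_vec[of b] by auto
    then show "pi_vec b \<in> sqrt7_lattice s"
      using lattice_sign(1)[OF s(2) t(2) s(1) t(1) prods(1)] by simp
    obtain d' where t: "d' \<in> {1, -1}" "pi_vec d \<in> sqrt7_lattice d'"
      using B bianchi_pi_vec[of d] by auto
    then show "pi_vec d \<in> sqrt7_lattice (- s)"
      using lattice_sign(2)[OF s(2) t(2) s(1) t(1) prods(3)] by simp
    obtain e' where t: "e' \<in> {1, -1}" "pi_vec e \<in> sqrt7_lattice e'"
      using B bianchi_pi_vec[of e] by auto
    then show "pi_vec e \<in> sqrt7_lattice (- s)"
      using lattice_sign(2)[OF s(2) t(2) s(1) t(1) prods(4)] by simp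
  qed
  then have "v \<in> sqrt7_lattice (- s)" unfolding v_def using s(2) lattice_exchange by blast
  \<comment> \<open>Each pair sum has norm 2 - 5 = -3 and the two sums have product -4, so the norm
    is 4 (-3) + (-3) + 16 = 1.\<close>
  moreover have "pedoe v v = 1"
    unfolding v_def pedoe_left pedoe_right using prods self[of a] self[of b] self[of d] self[of e]
    by (simp add: pedoe_commute)
  ultimately obtain C where C: "C \<in> oriented_bianchi_circles" "pi_vec C = v"
    using bianchi_circle_exists[of v "- s"] s(1) by auto
  have new: "new_peak P Q c = C"
    unfolding new_peak_def v[symmetric] C(2)[symmetric]
    using inv_into_f_f[OF inj_on_pi_vec] C(1) oriented_bianchi_circlesD by blast
  show ?pi using C(2) by (simp add: new v)
  have Cprods: "prod_circ C d = -5/2" "prod_circ C e = -5/2" "prod_circ C a = -1" "prod_circ C b = -1"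
    unfolding C(2) v_def pedoe_left using prods self[of a] self[of b] self[of d] self[of e]
    by (simp_all add: pedoe_commute)
  show ?split
    unfolding new unfolding tent_split_explicit P Q
    by (rule exI[of _ C], rule exI[of _ d], rule exI[of _ e], rule exI[of _ a], rule exI[of _ b])
      (use prods Cprods B C(1) in \<open>simp add: pedoe_commute\<close>)
  show ?notin
    using Cprods self[of d] self[of e] unfolding new unfolding Q by auto
qed

lemma new_peak_unique:
  assumes "tent_split (insert d Q) (P - {c})" "d \<notin> Q" "d \<in> oriented_circles"
  shows "d = new_peak P Q c"
proof -
  have fin: "finite Q" using tent_splitD(1)[OF assms(1)] by simp
  have "pi_vec d = 2 *\<^sub>R (\<Sum>p\<in>P - {c}. pi_vec p) - (\<Sum>q\<in>Q. pi_vec q)"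
    using tent_relation[OF assms(1)] assms(2) fin by (simp add: algebra_simps)
  then show ?thesis
    unfolding new_peak_def using inv_into_f_f[OF inj_on_pi_vec assms(3)] by simp
qed

section \<open>Edges and valence of the tent graph\<close>

definition neighbour :: "ocircle set \<Rightarrow> ocircle set \<Rightarrow> ocircle \<Rightarrow> ocircle set" where
  "neighbour P Q c = insert (new_peak P Q c) Q \<union> (P - {c})"

lemma neighbour_inj:
  assumes "tent_split P Q" "c \<in> P" "d \<in> P" "neighbour P Q c = neighbour P Q d"
  shows "c = d"
proof -
  have "P - {d} = P - {c}"
    using tent_split_unique(2)[OF tent_exchange(1)[OF assms(1,2)] tent_exchange(1)[OF assms(1,3)]]
      assms(4) unfolding neighbour_def by blast
  then show ?thesis using assms(2,3) by blast
qed

lemma neighbour_neq: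
  assumes "tent_split P Q" "c \<in> P"
  shows "neighbour P Q c \<noteq> P \<union> Q"
proof
  assume "neighbour P Q c = P \<union> Q"
  then have "P - {c} = Q"
    using tent_split_unique(2)[OF assms(1) tent_exchange(1)[OF assms]] unfolding neighbour_def
    by simp
  moreover have "P \<inter> Q = {}" "Q \<noteq> {}" using tent_splitD[OF assms(1)] by blast+
  ultimately show False by blast
qed

text \<open>This is how absence of backtracking enters: a step from the new tent that does not
  return must exchange one of the old base circles, not the new peak.\<close>

lemma neighbour_neighbour:
  assumes "tent_split P Q" "c \<in> P"
  shows "neighbour (insert (new_peak P Q c) Q) (P - {c}) (new_peak P Q c) = P \<union> Q"
proof -
  let ?d = "new_peak P Q c"
  have Q: "insert ?d Q - {?d} = Q" using tent_exchange(2)[OF assms] by blast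
  have "tent_split (insert c (P - {c})) (insert ?d Q - {?d})"
    using assms by (simp add: Q insert_absorb)
  moreover have "c \<in> oriented_circles"
    using assms tent_splitD(8) oriented_bianchi_circlesD by blast
  ultimately have "c = new_peak (insert ?d Q) (P - {c}) ?d"
    using new_peak_unique[of c "P - {c}" "insert ?d Q" ?d] by simp
  then show ?thesis
    unfolding neighbour_def using Q assms(2) by auto
qed

text \<open>Within the common belt, a base circle \<open>x\<close> of the second tent determines
  that tent's base as the class of \<open>x\<close>, so it is one of the two pairs of the belt. The
  other pair gives a neighbour by uniqueness of the new peak; the same pair gives equal removed
  peaks by \<open>tent_relation\<close>, hence equal tents.\<close>

lemma tent_edge_iff:
  assumes "tent_split P Q"
  shows "{P \<union> Q, T} \<in> tent_edges \<longleftrightarrow> (\<exists>c\<in>P. T = neighbour P Q c)"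
proof
  assume "{P \<union> Q, T} \<in> tent_edges"
  then obtain U V where UV: "{P \<union> Q, T} = {U, V}" "V \<in> tent_vertices" "U \<in> tent_vertices"
    "U \<noteq> V" "belts U \<inter> belts V \<noteq> {}"
    unfolding tent_edges_def mem_Collect_eq by (elim exE conjE) (rule that)
  have "P \<union> Q = U \<and> T = V \<or> P \<union> Q = V \<and> T = U" using UV(1) by (simp only: doubleton_eq_iff)
  then have T: "T \<in> tent_vertices" "T \<noteq> P \<union> Q" "belts (P \<union> Q) \<inter> belts T \<noteq> {}"
    using UV(2-5) by (metis, metis, metis inf_commute)
  obtain P' Q' where P': "tent_split P' Q'" "T = P' \<union> Q'"
    using T(1) unfolding tent_vertices_iff by blast
  obtain c c' where c: "c \<in> P" "c' \<in> P'" and eq: "(P - {c}) \<union> Q = (P' - {c'}) \<union> Q'"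
    using T(3) unfolding P'(2) belts_tent_split[OF assms] belts_tent_split[OF P'(1)] by blast
  note D = tent_splitD[OF assms] and D' = tent_splitD[OF P'(1)]
  obtain x where x: "x \<in> Q'" using D' by blast
  have Q': "Q' = {y \<in> (P - {c}) \<union> Q. prod_circ x y \<noteq> -1}"
    using x D'(10)[OF x] D'(11)[OF _ x] unfolding eq by (auto simp: pedoe_commute)
  have disj: "(P - {c}) \<inter> Q = {}" "(P' - {c'}) \<inter> Q' = {}" using D(5) D'(5) by blast+
  have split': "tent_split (insert c' (P' - {c'})) Q'" using P'(1) c(2) by (simp add: insert_absorb)
  show "\<exists>c\<in>P. T = neighbour P Q c"
  proof (cases "x \<in> P")
    case True
    then have "Q' = P - {c}"
      using D(9)[OF True] D(11)[OF True] unfolding Q' by auto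
    moreover from this have "P' - {c'} = Q" using disj eq by blast
    ultimately have "tent_split (insert c' Q) (P - {c})" "c' \<notin> Q" 
      using split' by auto
    moreover have "c' \<in> oriented_circles"
      using c(2) D'(8) oriented_bianchi_circlesD by blast
    ultimately have "c' = new_peak P Q c" using new_peak_unique by blast
    then have "T = neighbour P Q c"
      using \<open>Q' = P - {c}\<close> \<open>P' - {c'} = Q\<close> c(2) unfolding P'(2) neighbour_def by blast
    then show ?thesis using c(1) by blast
  next
    case False
    then have xQ: "x \<in> Q" using x eq by blast
    then have QQ: "Q' = Q"
      using D(10)[OF xQ] D(11)[OF _ xQ] unfolding Q' by (auto simp: pedoe_commute)
    then have PP: "P' - {c'} = P - {c}" using disj eq by blast
    have "pi_vec c + sum pi_vec (P - {c}) = pi_vec c' + sum pi_vec (P - {c})"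
      using tent_relation[OF assms] tent_relation[OF P'(1)] c D(1) D'(1)
      by (simp add: sum.remove[of P c] sum.remove[of P' c'] PP QQ)
    then have "pi_vec c = pi_vec c'" by (rule add_right_imp_eq)
    moreover have "c \<in> oriented_circles" "c' \<in> oriented_circles"
      using c D(8) D'(8) oriented_bianchi_circlesD by blast+
    ultimately have "c = c'" using inj_on_pi_vec by (auto dest: inj_onD)
    then have "P' = P" using PP c by blast
    then show ?thesis using T(2) QQ P'(2) by simp
  qed
next
  assume "\<exists>c\<in>P. T = neighbour P Q c"
  then obtain c where c: "c \<in> P" "T = neighbour P Q c" by blast
  let ?d = "new_peak P Q c"
  note ex = tent_exchange[OF assms c(1)]
  have "insert ?d Q - {?d} = Q" using ex(2) by blast
  then have "(P - {c}) \<union> Q \<in> belts T"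
    unfolding c(2) neighbour_def belts_tent_split[OF ex(1)] by blast
  moreover have "(P - {c}) \<union> Q \<in> belts (P \<union> Q)"
    unfolding belts_tent_split[OF assms] using c(1) by blast
  moreover have "T \<noteq> P \<union> Q" using neighbour_neq[OF assms c(1)] c(2) by simp
  moreover have "T \<in> tent_vertices" "P \<union> Q \<in> tent_vertices"
    unfolding tent_vertices_iff c(2) neighbour_def using ex(1) assms by blast+
  ultimately show "{P \<union> Q, T} \<in> tent_edges" unfolding tent_edges_def by blast
qed

lemma tent_valence:
  assumes "T \<in> tent_vertices"
  shows "valence tent_edges T = 3"
proof -
  obtain P Q where PQ: "tent_split P Q" "T = P \<union> Q" using assms unfolding tent_vertices_iff by blast
  have "\<exists>U. e = {T, U}" if e: "e \<in> tent_edges" "T \<in> e" for e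
  proof -
    obtain U V where "e = {U, V}"
      using e(1) unfolding tent_edges_def mem_Collect_eq by (elim exE conjE) (rule that)
    then show ?thesis using e(2) insert_commute[of U V] by (metis insertE singletonD)
  qed
  then have "{e \<in> tent_edges. T \<in> e} = {{T, U} | U. {T, U} \<in> tent_edges}" by blast
  also have "\<dots> = (\<lambda>c. {T, neighbour P Q c}) ` P"
    unfolding PQ(2) tent_edge_iff[OF PQ(1)] by blast
  finally have eq: "{e \<in> tent_edges. T \<in> e} = (\<lambda>c. {T, neighbour P Q c}) ` P" .
  have "inj_on (\<lambda>c. {T, neighbour P Q c}) P"
    using neighbour_inj[OF PQ(1)] by (auto simp: inj_on_def doubleton_eq_iff)
  then show ?thesis unfolding valence_def eq using tent_splitD(3)[OF PQ(1)] by (simp add: card_image)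
qed

section \<open>Monotone walks and the absence of cycles\<close>

text \<open>
  The invariant of a step from \<open>T\<close> to \<open>U\<close> along a walk without backtracking, for the linear functional
  \<open>\<lambda>v. pedoe v s\<close>.
\<close>

definition ascending :: "real^4 \<Rightarrow> ocircle set \<Rightarrow> ocircle set \<Rightarrow> bool" where
  "ascending s T U \<longleftrightarrow> (\<exists>P Q c. tent_split P Q \<and> c \<in> P \<and> T = P \<union> Q \<and> U = neighbour P Q c \<and>
     (\<forall>x\<in>P \<union> Q. pedoe (pi_vec x) s \<ge> 0) \<and>
     pedoe (pi_vec c) s < (\<Sum>q\<in>Q. pedoe (pi_vec q) s))"

lemma pedoe_sum_left: "pedoe (\<Sum>x\<in>A. f x) s = (\<Sum>x\<in>A. pedoe (f x) s)"
  by (induction A rule: infinite_finite_induct) (simp_all add: pedoe_left)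

lemma tent_relation_pedoe:
  assumes "tent_split P Q"
  shows "(\<Sum>p\<in>P. pedoe (pi_vec p) s) = 2 * (\<Sum>q\<in>Q. pedoe (pi_vec q) s)"
  using arg_cong[OF tent_relation[OF assms], of "\<lambda>v. pedoe v s"]
  by (simp add: pedoe_sum_left pedoe_left)

text \<open>The base sum refers to a splitting, the sum over the whole tent only to the vertex.
  Their proportionality lets the latter measure progress along a walk.\<close>

lemma tent_mass:
  assumes "tent_split P Q"
  shows "(\<Sum>x\<in>P \<union> Q. pedoe (pi_vec x) s) = 3 * (\<Sum>q\<in>Q. pedoe (pi_vec q) s)"
  using tent_relation_pedoe[OF assms] tent_splitD[OF assms] by (simp add: sum.union_disjoint)

lemma ascending_mass:
  assumes "ascending s T U"
  shows "(\<Sum>x\<in>T. pedoe (pi_vec x) s) < (\<Sum>x\<in>U. pedoe (pi_vec x) s)"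
proof -
  obtain P Q c where *: "tent_split P Q" "c \<in> P" "T = P \<union> Q" "U = neighbour P Q c"
    "pedoe (pi_vec c) s < (\<Sum>q\<in>Q. pedoe (pi_vec q) s)"
    using assms unfolding ascending_def by blast
  show ?thesis
    using tent_relation_pedoe[OF *(1), of s] *(5) sum.remove[OF tent_splitD(1)[OF *(1)] *(2)]
    unfolding *(3,4) neighbour_def tent_mass[OF *(1)] tent_mass[OF tent_exchange(1)[OF *(1,2)]]
    by (smt (verit))
qed

lemma ascending_step:
  assumes "ascending s T U" "{U, V} \<in> tent_edges" "V \<noteq> T"
  shows "ascending s U V"
proof -
  let ?f = "\<lambda>x. pedoe (pi_vec x) s"
  obtain P Q c where *: "tent_split P Q" "c \<in> P" "T = P \<union> Q" "U = neighbour P Q c"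
    and nonneg: "\<And>x. x \<in> P \<union> Q \<Longrightarrow> ?f x \<ge> 0" and less: "?f c < sum ?f Q"
    using assms(1) unfolding ascending_def by blast
  let ?d = "new_peak P Q c"
  note ex = tent_exchange[OF *(1,2)] and fin = tent_splitD(1,2)[OF *(1)]
  obtain x where x: "x \<in> insert ?d Q" "V = neighbour (insert ?d Q) (P - {c}) x"
    using assms(2) tent_edge_iff[OF ex(1)] unfolding *(4) neighbour_def by blast
  have xQ: "x \<in> Q" using x neighbour_neighbour[OF *(1,2)] assms(3) *(3) by blast
  have base: "sum ?f Q < sum ?f (P - {c})"
    using tent_relation_pedoe[OF *(1), of s] less sum.remove[OF fin(1) *(2), of ?f] by linarith
  have "?f ?d = 2 * sum ?f (P - {c}) - sum ?f Q"
    by (simp add: ex(3) pedoe_left pedoe_sum_left)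
  moreover have "sum ?f Q \<ge> 0" using nonneg by (intro sum_nonneg) blast
  ultimately have "?f ?d \<ge> 0" using base by linarith
  then have "\<forall>y\<in>insert ?d Q \<union> (P - {c}). ?f y \<ge> 0" using nonneg by blast
  \<comment> \<open>Here nonnegativity is used: one base value is at most the old base sum, which is
    below the new one.\<close>
  moreover have "?f x \<le> sum ?f Q"
    using xQ nonneg fin(2) by (intro member_le_sum) auto
  then have "?f x < sum ?f (P - {c})" using base by linarith
  ultimately show ?thesis
    unfolding ascending_def using ex(1) x *(4) unfolding neighbour_def by blast
qed

text \<open>The functional takes the value 1 + 1 = 2 on each peak and -(1 - 5/2) = 3/2 on each base
  circle, and 2 lies below the base sum 3.\<close>

lemma ascending_start:
  assumes "tent_split P Q" "{P \<union> Q, U} \<in> tent_edges"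
  shows "ascending (- (\<Sum>q\<in>Q. pi_vec q)) (P \<union> Q) U"
proof -
  let ?s = "- (\<Sum>q\<in>Q. pi_vec q)"
  obtain d e where Q: "Q = {d, e}" "d \<noteq> e" using tent_splitD(4)[OF assms(1)] unfolding card_2_iff by blast
  have p: "pedoe (pi_vec p) ?s = 2" if "p \<in> P" for p
    using Q that tent_splitD(11)[OF assms(1) that] by (simp add: pedoe_right)
  have de: "prod_circ d e = -5/2" "prod_circ e d = -5/2"
    using assms(1) Q unfolding tent_split_def by auto
  have "prod_circ d d = 1" "prod_circ e e = 1"
    using tent_splitD(8)[OF assms(1)] Q pedoe_pi_vec_self oriented_bianchi_circlesD by auto
  then have q: "pedoe (pi_vec q) ?s = 3/2" if "q \<in> Q" for q
    using Q that de by (auto simp: pedoe_right)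
  have "(\<Sum>q\<in>Q. pedoe (pi_vec q) ?s) = 3"
    using tent_splitD(4)[OF assms(1)] by (simp add: q)
  moreover have "\<forall>x\<in>P \<union> Q. pedoe (pi_vec x) ?s \<ge> 0"
  proof
    fix x assume "x \<in> P \<union> Q"
    then have "pedoe (pi_vec x) ?s = 2 \<or> pedoe (pi_vec x) ?s = 3/2" using p q by blast
    then show "pedoe (pi_vec x) ?s \<ge> 0" by (elim disjE) simp_all
  qed
  moreover obtain c where "c \<in> P" "U = neighbour P Q c"
    using assms(2) unfolding tent_edge_iff[OF assms(1)] by blast
  moreover have "pedoe (pi_vec c) ?s < (\<Sum>q\<in>Q. pedoe (pi_vec q) ?s)"
    using calculation(1) p[OF \<open>c \<in> P\<close>] by simp
  ultimately show ?thesis unfolding ascending_def using assms(1) by blast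
qed

lemma tent_edges_forest: "is_forest tent_edges"
  unfolding is_forest_def
proof
  assume "\<exists>vs. cycle_in tent_edges vs"
  then obtain vs where vs: "3 \<le> length vs" "distinct vs"
    "\<And>i. i < length vs \<Longrightarrow> {vs ! i, vs ! (Suc i mod length vs)} \<in> tent_edges"
    unfolding cycle_in_def by blast
  define n where "n = length vs"
  \<comment> \<open>Indices modulo \<open>n\<close> unroll the cycle into an endless periodic walk.
    Distinctness and length at least 3 exclude backtracking, also where the list closes up.\<close>
  define u where "u i = vs ! (i mod n)" for i
  have n: "3 \<le> n" using vs(1) by (simp add: n_def)
  have edge: "{u i, u (Suc i)} \<in> tent_edges" for i
    using vs(3)[of "i mod n"] n by (simp add: u_def n_def[symmetric] mod_Suc_eq)
  have neq: "u (Suc (Suc i)) \<noteq> u i" for i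
  proof
    assume "u (Suc (Suc i)) = u i"
    then have "Suc (Suc i) mod n = i mod n"
      using vs(2) n unfolding u_def n_def by (subst (asm) nth_eq_iff_index_eq) (auto intro!: mod_less_divisor)
    then have "n dvd 2" using mod_eq_dvd_iff_nat[of i "Suc (Suc i)" n] by simp
    then show False using n by (auto dest: dvd_imp_le)
  qed
  have "u 0 \<in> tent_vertices"
    using edge[of 0] unfolding tent_edges_def mem_Collect_eq doubleton_eq_iff by metis
  then obtain P Q where PQ: "tent_split P Q" "u 0 = P \<union> Q" unfolding tent_vertices_iff by blast
  define s where "s = - (\<Sum>q\<in>Q. pi_vec q)"
  define m where "m i = (\<Sum>x\<in>u i. pedoe (pi_vec x) s)" for i
  have asc: "ascending s (u i) (u (Suc i))" for i
  proof (induction i)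
    case 0
    show ?case using ascending_start[OF PQ(1)] edge[of 0] unfolding PQ(2) s_def by blast
  next
    case (Suc i)
    show ?case using ascending_step[OF Suc edge neq] .
  qed
  have "strict_mono m"
    unfolding strict_mono_Suc_iff m_def using ascending_mass[OF asc] by blast
  then have "m 0 < m n" using n by (intro strict_monoD[of m]) simp_all
  moreover have "u n = u 0" by (simp add: u_def)
  ultimately show False by (simp add: m_def)
qed


section \<open>The belt-exchange matrices\<close>

text \<open>The second component of a letter is ignored: in a reduced word it is always 1, the only
  nontrivial element of Z/2.\<close>

definition word_matrix :: "(nat \<times> int) list \<Rightarrow> real^4^4" where
  "word_matrix w = foldr (\<lambda>x A. exchange (fst x) ** A) w (mat 1)"

lemma word_matrix_simps [simp]:
  "word_matrix [] = mat 1"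
  "word_matrix (x # w) = exchange (fst x) ** word_matrix w"
  by (simp_all add: word_matrix_def)

abbreviation free_product_Z2 :: "(nat \<times> int) list monoid" where
  "free_product_Z2 \<equiv> free_product {..<3} (\<lambda>k::nat. integer_mod_group 2)"

lemma group_free_product_Z2: "group free_product_Z2"
  by (rule group_free_product) simp

lemma group_GL4: "group GL4"
  unfolding GL4_def
proof (rule monoid.units_group)
  show "Group.monoid \<lparr>carrier = UNIV, monoid.mult = (**), one = mat 1 :: real^4^4\<rparr>"
    by unfold_locales (simp_all add: matrix_mul_assoc)
qed

lemma GL4_simps [simp]: "x \<otimes>\<^bsub>GL4\<^esub> y = x ** y" "\<one>\<^bsub>GL4\<^esub> = mat 1"
  by (simp_all add: GL4_def units_of_def)

lemma Cons_reduced_words: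
  "x # w \<in> reduced_words {..<3} (\<lambda>k::nat. integer_mod_group 2) \<longleftrightarrow>
     fst x < 3 \<and> snd x = 1 \<and> w \<in> reduced_words {..<3} (\<lambda>k::nat. integer_mod_group 2) \<and>
     (w = [] \<or> fst x \<noteq> fst (hd w))"
  by (cases w; cases x) (auto simp: reduced_words_def carrier_integer_mod_group)

lemma word_matrix_word_cons:
  assumes "i < 3" "w \<in> reduced_words {..<3} (\<lambda>k::nat. integer_mod_group 2)"
  shows "word_matrix (word_cons (\<lambda>k. integer_mod_group 2) (i, 1) w) = exchange i ** word_matrix w"
proof (cases w)
  case (Cons y v)
  then have "y = (fst y, 1)" using assms by (cases y) (simp add: Cons_reduced_words)
  then obtain j where "y = (j, 1)" by blast
  then show ?thesis
    using Cons assms(1) by (simp add: matrix_mul_assoc exchange_involution)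
qed simp

lemma word_matrix_hom: "word_matrix \<in> hom free_product_Z2 GL4"
proof (rule homI)
  interpret F: group free_product_Z2 by (rule group_free_product_Z2)
  interpret GL: group GL4 by (rule group_GL4)
  fix u assume u: "u \<in> carrier free_product_Z2"
  then show "word_matrix u \<in> carrier GL4"
  proof (induction u)
    case Nil
    show ?case using GL.one_closed by simp
  next
    case (Cons x u)
    then show ?case
      using GL.m_closed[of "exchange (fst x)" "word_matrix u"]
      by (simp add: free_product_def Cons_reduced_words exchange_in_GL4)
  qed
  fix v assume v: "v \<in> carrier free_product_Z2"
  show "word_matrix (u \<otimes>\<^bsub>free_product_Z2\<^esub> v) = word_matrix u \<otimes>\<^bsub>GL4\<^esub> word_matrix v"
    using u
  proof (induction u)
    case Nil
    show ?case by (simp add: free_product_def)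
  next
    case (Cons x u)
    obtain i where x: "x = (i, 1)" and i: "i < 3" and u: "u \<in> carrier free_product_Z2"
      using Cons.prems by (cases x) (auto simp: free_product_def Cons_reduced_words)
    have "u \<otimes>\<^bsub>free_product_Z2\<^esub> v \<in> reduced_words {..<3} (\<lambda>k. integer_mod_group 2)"
      using F.m_closed[OF u v] by (simp add: free_product_def)
    from word_matrix_word_cons[OF i this] Cons.IH[OF u] show ?case
      by (simp add: x free_product_def matrix_mul_assoc)
  qed
qed

section \<open>Growth of the base value along reduced words\<close>

text \<open>
  A row vector \<open>x\<close> lists the values of a linear functional on \<open>C\<^sub>1, \<dots>, C\<^sub>4\<close>; its value on the third
  peak is forced by \<open>\<pi>(C\<^sub>1) + \<pi>(C\<^sub>3) + \<pi>(C\<^sub>5) = 2 (\<pi>(C\<^sub>2) + \<pi>(C\<^sub>4))\<close>. The matrix \<open>exchange k\<close> replaces the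
  peak with index \<open>k\<close> in the order \<open>C\<^sub>5, C\<^sub>1, C\<^sub>3\<close>.
\<close>

definition peak_value :: "nat \<Rightarrow> real^4 \<Rightarrow> real" where
  "peak_value k x = [2 * (x$2 + x$4) - x$1 - x$3, x$1, x$3] ! k"

definition base_value :: "real^4 \<Rightarrow> real" where
  "base_value x = x$2 + x$4"

definition nonneg_values :: "real^4 \<Rightarrow> bool" where
  "nonneg_values x \<longleftrightarrow> x$2 \<ge> 0 \<and> x$4 \<ge> 0 \<and> (\<forall>k<3. peak_value k x \<ge> 0)"

lemma less_3_cases: "(\<forall>k<3. P k) \<longleftrightarrow> P 0 \<and> P 1 \<and> P (2::nat)"
  by (auto simp: numeral_3_eq_3 numeral_2_eq_2 less_Suc_eq)

text \<open>The new peak keeps the index \<open>k\<close> of the removed one, so j \<noteq> k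
  singles out the old base circles. By the tent relation the new peak is also 3 (C2 + C4) - 2 c for
  the removed peak c, which explains the entries 3 and -2 of the matrices.\<close>

lemma exchange_step:
  assumes "k < 3" "nonneg_values x" "peak_value k x < base_value x"
  shows "nonneg_values (x v* exchange k)" "base_value x < base_value (x v* exchange k)"
    "j < 3 \<Longrightarrow> j \<noteq> k \<Longrightarrow> peak_value j (x v* exchange k) < base_value (x v* exchange k)"
proof -
  have k: "k = 0 \<or> k = 1 \<or> k = 2" using assms(1) by auto
  have j: "j = 0 \<or> j = 1 \<or> j = 2" if "j < 3" using that by auto
  note defs = nonneg_values_def less_3_cases peak_value_def base_value_def exchange_def
    vector_matrix_mult_def sum_4 vector_4
  show "nonneg_values (x v* exchange k)" "base_value x < base_value (x v* exchange k)"
    using k assms(2,3) by (auto simp: defs)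
  show "j < 3 \<Longrightarrow> j \<noteq> k \<Longrightarrow> peak_value j (x v* exchange k) < base_value (x v* exchange k)"
    using k assms(2,3) j by (auto simp: defs)
qed

text \<open>A row vector meets the leftmost letter first, so a word is read from left to right as a
  walk; distinct adjacent letters mean that the walk does not backtrack.\<close>

lemma base_value_word_matrix:
  assumes "w \<in> reduced_words {..<3} (\<lambda>k::nat. integer_mod_group 2)" "w \<noteq> []"
    "nonneg_values x" "peak_value (fst (hd w)) x < base_value x"
  shows "base_value x < base_value (x v* word_matrix w)"
  using assms
proof (induction w arbitrary: x)
  case (Cons y w)
  let ?x = "x v* exchange (fst y)"
  have y: "fst y < 3" and w: "w \<in> reduced_words {..<3} (\<lambda>k::nat. integer_mod_group 2)"
    using Cons.prems(1) by (simp_all add: Cons_reduced_words)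
  have less: "base_value x < base_value ?x"
    using exchange_step(2)[OF y] Cons.prems by simp
  have eq: "x v* word_matrix (y # w) = ?x v* word_matrix w"
    by (simp add: vector_matrix_mul_assoc)
  show ?case
  proof (cases "w = []")
    case True
    then show ?thesis using less by simp
  next
    case False
    then have "fst (hd w) < 3" "fst (hd w) \<noteq> fst y"
      using Cons.prems(1) w by (cases w; simp add: Cons_reduced_words)+
    then have "base_value ?x < base_value (?x v* word_matrix w)"
      using Cons.IH[OF w False] exchange_step[OF y] Cons.prems by simp
    with less show ?thesis unfolding eq by linarith
  qed
qed simp

lemma word_matrix_eq_one_iff:
  assumes "w \<in> reduced_words {..<3} (\<lambda>k::nat. integer_mod_group 2)" "word_matrix w = mat 1"
  shows "w = []"
proof (rule ccontr)
  assume w: "w \<noteq> []"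
  \<comment> \<open>Twice the values 2 on peaks and 3/2 on base circles of the functional that
    starts the forest argument; the third peak value is again 4, below the base value 6.\<close>
  let ?x = "vector [4, 3, 4, 3] :: real^4"
  have "fst (hd w) < 3" using assms(1) w by (cases w) (auto simp: Cons_reduced_words)
  then have "\<forall>k<3. peak_value k ?x < base_value ?x" "nonneg_values ?x" 
    by (simp_all add: less_3_cases nonneg_values_def peak_value_def base_value_def vector_4)
  then have "base_value ?x < base_value (?x v* word_matrix w)"
    using base_value_word_matrix[OF assms(1) w] \<open>fst (hd w) < 3\<close> by blast
  then show False by (simp add: assms(2))
qed

lemma word_matrix_iso:
  "word_matrix \<in> iso free_product_Z2 (subgroup_generated GL4 {exchange k | k. k < 3})"
proof -
  let ?S = "{exchange k | k. k < 3}" and ?F = free_product_Z2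
  interpret F: group ?F by (rule group_free_product_Z2)
  interpret GL: group GL4 by (rule group_GL4)
  interpret S: group "subgroup_generated GL4 ?S" by (rule GL.group_subgroup_generated)
  interpret h: group_hom ?F GL4 word_matrix
    by unfold_locales (rule word_matrix_hom)
  have letter: "[(k, 1)] \<in> carrier ?F" if "k < 3" for k
    using that by (simp add: free_product_def reduced_words_def)
  have S: "?S \<subseteq> word_matrix ` carrier ?F"
  proof
    fix A assume "A \<in> ?S"
    then obtain k where "k < 3" "A = exchange k" by blast
    then show "A \<in> word_matrix ` carrier ?F"
      using letter[of k] by (intro image_eqI[of _ _ "[(k, 1)]"]) simp_all
  qed
  have "carrier (subgroup_generated GL4 ?S) \<subseteq> word_matrix ` carrier ?F"
    using GL.subgroup_generated_minimal[OF h.img_is_subgroup S] .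
  moreover have "word_matrix w \<in> carrier (subgroup_generated GL4 ?S)" if "w \<in> carrier ?F" for w
    using that
  proof (induction w)
    case Nil
    show ?case using S.one_closed by (simp only: one_subgroup_generated GL4_simps word_matrix_simps)
  next
    case (Cons x w)
    then have "exchange (fst x) \<in> ?S" and w: "w \<in> carrier ?F"
      by (auto simp: free_product_def Cons_reduced_words)
    then have "exchange (fst x) \<in> carrier (subgroup_generated GL4 ?S)"
      using GL.subgroup_generated_subset_carrier_subset[of ?S] exchange_in_GL4 by blast
    from S.m_closed[OF this Cons.IH[OF w]] show ?case
      by (simp only: mult_subgroup_generated GL4_simps word_matrix_simps)
  qed
  ultimately have img: "word_matrix ` carrier ?F = carrier (subgroup_generated GL4 ?S)" by blast
  have "inj_on word_matrix (carrier ?F)"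
    unfolding h.inj_on_one_iff
    using word_matrix_eq_one_iff by (auto simp: free_product_def)
  then show ?thesis
    using img word_matrix_hom by (auto simp: iso_def bij_betw_def hom_def)
qed

theorem theorem14p3:
  shows "is_forest tent_edges \<and> (\<forall>T \<in> tent_vertices. valence tent_edges T = 3) \<and>
    (\<exists>\<phi> \<in> iso (free_product {..<3} (\<lambda>k::nat. integer_mod_group 2))
               (subgroup_generated GL4 {exchange k | k. k < 3}).
       \<forall>k<3. \<phi> [(k, 1)] = exchange k)"
proof (intro conjI)
  show "\<exists>\<phi> \<in> iso (free_product {..<3} (\<lambda>k::nat. integer_mod_group 2))
      (subgroup_generated GL4 {exchange k | k. k < 3}). \<forall>k<3. \<phi> [(k, 1)] = exchange k"
    using word_matrix_iso by (intro bexI[of _ word_matrix]) simp_all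
qed (use tent_edges_forest tent_valence in blast)+

end
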